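(* If $G$ is the incidence graph of a finite projective plane $\Pi$ of order $q$, then \[2q^2-2\sqrt{q}\le \mathrm{dmg}(G)\le 2q^2-2.\] Furthermore: \begin{itemize} \item if $\Pi$ does not contain a Baer subplane, then $\mathrm{dmg}(G)=2q^2-2$; \item if $\Pi$ contains a Baer subplane and is doubly transitive, then $\mathrm{dmg}(G)=2q^2-2\sqrt{q}$. \end{itemize}
   Context: A finite projective plane is a finite collection of points and lines such that (1) any two distinct lines contain exactly one common point; (2) any two distinct points belong to exactly one common line; (3) there exist four points, of which no line contains more than two. It has order $q$ if every line contains $q+1$ points and every point lies on $q+1$ lines. The incidence graph of $\Pi$ has one vertex for each point and one vertex for each line of $\Pi$, with edges joining each line to all points on that line. A Baer subplane of a projective plane of order $q$ is a subplane of order $\sqrt{q}$. $\Pi$ is doubly transitive if for any two pairs $x,y$ and $x',y'$ of (distinct) points there is an automorphism $\phi$ of $\Pi$ with $\phi(x)=x'$ and $\phi(y)=y'$, and likewise for any two pairs $\ell_1,\ell_2$ and $\ell_1',\ell_2'$ of (distinct) lines there is an automorphism mapping $\ell_1$ to $\ell_1'$ and $\ell_2$ to $\ell_2'$. Damage number. One cop and one robber play on a graph $G$ with perfect information. First the cop chooses a starting vertex, then the robber chooses a starting vertex (this placement is round $0$). Each subsequent round consists of a move of the cop followed by a move of the robber; in a move a player either stays at the current vertex or moves to a neighboring vertex. If the cop ever occupies the same vertex as the robber, the robber is captured and the game ends. If a vertex $v$ is occupied by the robber at the end of a round and the robber is not caught in the following round, then $v$ becomes damaged and stays damaged for the rest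 of the game. The cop wants to minimize, and the robber to maximize, the number of damaged vertices. The damage number $\mathrm{dmg}(G)$ is the number of damaged vertices when both play optimally, i.e. the maximum number of vertices the robber can guarantee to damage no matter the strategy of the cop. *)

theory Defs
  imports Complex_Main "Graph_Theory.Pair_Digraph"
begin

section \<open>Finite projective planes\<close>

text \<open>
  A plane is given by its points \<open>P\<close>, its lines \<open>L\<close> and an incidence relation \<open>I\<close>, where
  \<open>I x l\<close> reads "the point \<open>x\<close> lies on the line \<open>l\<close>". Only the values of \<open>I\<close> on \<open>P\<close> and \<open>L\<close> matter.
\<close>

locale finite_projective_plane =
  fixes P :: "'p set" and L :: "'l set" and I :: "'p \<Rightarrow> 'l \<Rightarrow> bool"
  assumes finite_points: "finite P"
    and finite_lines: "finite L"
    and lines_meet: "\<lbrakk>l \<in> L; m \<in> L; l \<noteq> m\<rbrakk> \<Longrightarrow> \<exists>!x. x \<in> P \<and> I x l \<and> I x m"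
    and points_join: "\<lbrakk>x \<in> P; y \<in> P; x \<noteq> y\<rbrakk> \<Longrightarrow> \<exists>!l. l \<in> L \<and> I x l \<and> I y l"
    and quadrangle: "\<exists>Q\<subseteq>P. card Q = 4 \<and> (\<forall>l\<in>L. card {x \<in> Q. I x l} \<le> 2)"

definition has_order :: "'p set \<Rightarrow> 'l set \<Rightarrow> ('p \<Rightarrow> 'l \<Rightarrow> bool) \<Rightarrow> nat \<Rightarrow> bool" where
  "has_order P L I q \<longleftrightarrow>
     (\<forall>l\<in>L. card {x \<in> P. I x l} = q + 1) \<and> (\<forall>x\<in>P. card {l \<in> L. I x l} = q + 1)"

definition subplane ::
    "'p set \<Rightarrow> 'l set \<Rightarrow> 'p set \<Rightarrow> 'l set \<Rightarrow> ('p \<Rightarrow> 'l \<Rightarrow> bool) \<Rightarrow> bool" where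
  "subplane P' L' P L I \<longleftrightarrow> P' \<subseteq> P \<and> L' \<subseteq> L \<and> finite_projective_plane P' L' I"

definition contains_Baer_subplane ::
    "'p set \<Rightarrow> 'l set \<Rightarrow> ('p \<Rightarrow> 'l \<Rightarrow> bool) \<Rightarrow> nat \<Rightarrow> bool" where
  "contains_Baer_subplane P L I q \<longleftrightarrow>
     (\<exists>P' L' r. subplane P' L' P L I \<and> has_order P' L' I r \<and> real r = sqrt (real q))"

text \<open>An automorphism is given by its actions \<open>f\<close> on the points and \<open>g\<close> on the lines.\<close>

definition plane_automorphism ::
    "'p set \<Rightarrow> 'l set \<Rightarrow> ('p \<Rightarrow> 'l \<Rightarrow> bool) \<Rightarrow> ('p \<Rightarrow> 'p) \<Rightarrow> ('l \<Rightarrow> 'l) \<Rightarrow> bool" where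
  "plane_automorphism P L I f g \<longleftrightarrow>
     bij_betw f P P \<and> bij_betw g L L \<and> (\<forall>x\<in>P. \<forall>l\<in>L. I (f x) (g l) \<longleftrightarrow> I x l)"

definition doubly_transitive :: "'p set \<Rightarrow> 'l set \<Rightarrow> ('p \<Rightarrow> 'l \<Rightarrow> bool) \<Rightarrow> bool" where
  "doubly_transitive P L I \<longleftrightarrow>
     (\<forall>x\<in>P. \<forall>y\<in>P. \<forall>x'\<in>P. \<forall>y'\<in>P. x \<noteq> y \<and> x' \<noteq> y' \<longrightarrow>
        (\<exists>f g. plane_automorphism P L I f g \<and> f x = x' \<and> f y = y')) \<and>
     (\<forall>l\<in>L. \<forall>m\<in>L. \<forall>l'\<in>L. \<forall>m'\<in>L. l \<noteq> m \<and> l' \<noteq> m' \<longrightarrow>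
        (\<exists>f g. plane_automorphism P L I f g \<and> g l = l' \<and> g m = m'))"

text \<open>An undirected graph is a digraph satisfying \<^locale>\<open>pair_graph\<close>: each edge is a pair of opposite arcs.\<close>

definition incidence_graph ::
    "'p set \<Rightarrow> 'l set \<Rightarrow> ('p \<Rightarrow> 'l \<Rightarrow> bool) \<Rightarrow> ('p + 'l) pair_pre_digraph" where
  "incidence_graph P L I =
     \<lparr> pverts = P <+> L,
       parcs = {(Inl x, Inr l) | x l. x \<in> P \<and> l \<in> L \<and> I x l} \<union>
               {(Inr l, Inl x) | x l. x \<in> P \<and> l \<in> L \<and> I x l} \<rparr>"

lemma (in finite_projective_plane) pair_graph_incidence_graph:
  "pair_graph (incidence_graph P L I)"
proof -
  have fin: "finite (pverts (incidence_graph P L I))"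
    by (simp add: incidence_graph_def finite_points finite_lines)
  have sub: "parcs (incidence_graph P L I)
      \<subseteq> pverts (incidence_graph P L I) \<times> pverts (incidence_graph P L I)"
    by (auto simp: incidence_graph_def)
  have "finite (parcs (incidence_graph P L I))"
    using finite_subset[OF sub] fin by simp
  moreover have "symmetric (with_proj (incidence_graph P L I))"
    unfolding symmetric_def sym_def by (auto simp: incidence_graph_def)
  ultimately show ?thesis
    using fin sub by unfold_locales (auto simp: incidence_graph_def)
qed


section \<open>The damage number\<close>

text \<open>
  A history lists the positions (cop, robber) at the ends of the rounds played so far, the most
  recent round first. A cop strategy maps it to the cop's next position; a robber strategy maps
  it, together with the cop's position just chosen, to the robber's next position. On the empty
  history the strategies give the starting vertices. Legality is demanded on all
  histories, including unreachable ones; this is no restriction, since staying is always legal.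
\<close>

type_synonym 'v cop_strategy = "('v \<times> 'v) list \<Rightarrow> 'v"
type_synonym 'v robber_strategy = "('v \<times> 'v) list \<Rightarrow> 'v \<Rightarrow> 'v"

definition moves :: "'v pair_pre_digraph \<Rightarrow> 'v \<Rightarrow> 'v set" where
  "moves G v = insert v {w. (v, w) \<in> parcs G}"

definition legal_cop :: "'v pair_pre_digraph \<Rightarrow> 'v cop_strategy \<Rightarrow> bool" where
  "legal_cop G \<sigma> \<longleftrightarrow> \<sigma> [] \<in> pverts G \<and> (\<forall>h c r. \<sigma> ((c, r) # h) \<in> moves G c)"

definition legal_robber :: "'v pair_pre_digraph \<Rightarrow> 'v robber_strategy \<Rightarrow> bool" where
  "legal_robber G \<rho> \<longleftrightarrow>
     (\<forall>c. \<rho> [] c \<in> pverts G) \<and> (\<forall>h c r c'. \<rho> ((c, r) # h) c' \<in> moves G r)"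

text \<open>\<open>history \<sigma> \<rho> n\<close> records the rounds \<open>0, \<dots>, n - 1\<close>.\<close>

primrec history :: "'v cop_strategy \<Rightarrow> 'v robber_strategy \<Rightarrow> nat \<Rightarrow> ('v \<times> 'v) list" where
  "history \<sigma> \<rho> 0 = []"
| "history \<sigma> \<rho> (Suc n) =
     (let h = history \<sigma> \<rho> n; c = \<sigma> h in (c, \<rho> h c) # h)"

definition cop_pos :: "'v cop_strategy \<Rightarrow> 'v robber_strategy \<Rightarrow> nat \<Rightarrow> 'v" where
  "cop_pos \<sigma> \<rho> n = fst (hd (history \<sigma> \<rho> (Suc n)))"

definition robber_pos :: "'v cop_strategy \<Rightarrow> 'v robber_strategy \<Rightarrow> nat \<Rightarrow> 'v" where
  "robber_pos \<sigma> \<rho> n = snd (hd (history \<sigma> \<rho> (Suc n)))"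

text \<open>The players can come to share a vertex by the robber's move or by the cop's move.\<close>

definition captured_in :: "'v cop_strategy \<Rightarrow> 'v robber_strategy \<Rightarrow> nat \<Rightarrow> bool" where
  "captured_in \<sigma> \<rho> n \<longleftrightarrow>
     cop_pos \<sigma> \<rho> n = robber_pos \<sigma> \<rho> n \<or>
     (\<exists>m. n = Suc m \<and> cop_pos \<sigma> \<rho> n = robber_pos \<sigma> \<rho> m)"

text \<open>
  Histories are infinite for convenience, but the game ends with the first capture: the robber's
  position at the end of round \<open>n\<close> counts only if there is no capture in the rounds \<open>0, \<dots>, n + 1\<close>.
\<close>

definition damaged :: "'v cop_strategy \<Rightarrow> 'v robber_strategy \<Rightarrow> 'v set" where
  "damaged \<sigma> \<rho> = {robber_pos \<sigma> \<rho> n | n. \<forall>m \<le> Suc n. \<not> captured_in \<sigma> \<rho> m}"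

definition robber_guarantees :: "'v pair_pre_digraph \<Rightarrow> nat \<Rightarrow> bool" where
  "robber_guarantees G k \<longleftrightarrow>
     (\<exists>\<rho>. legal_robber G \<rho> \<and> (\<forall>\<sigma>. legal_cop G \<sigma> \<longrightarrow> k \<le> card (damaged \<sigma> \<rho>)))"

definition dmg :: "'v pair_pre_digraph \<Rightarrow> nat" where
  "dmg G = (GREATEST k. robber_guarantees G k)"

text \<open>The maximum exists for every nonempty finite graph.\<close>

lemma robber_pos_in_verts:
  assumes "pair_wf_digraph G" and "legal_robber G \<rho>"
  shows "robber_pos \<sigma> \<rho> n \<in> pverts G"
proof (induction n)
  case 0
  then show ?case using assms(2) by (simp add: robber_pos_def legal_robber_def Let_def)
next
  case (Suc n)
  let ?h = "history \<sigma> \<rho> n"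
  have "robber_pos \<sigma> \<rho> (Suc n) \<in> moves G (robber_pos \<sigma> \<rho> n)"
    using assms(2) by (simp add: robber_pos_def legal_robber_def Let_def)
  then show ?case
    using Suc pair_wf_digraph.in_arcsD2[OF assms(1)] by (auto simp: moves_def)
qed

lemma
  assumes "pair_fin_digraph G" and "pverts G \<noteq> {}"
  shows robber_guarantees_dmg: "robber_guarantees G (dmg G)"
    and robber_guarantees_le_dmg: "robber_guarantees G k \<Longrightarrow> k \<le> dmg G"
proof -
  interpret pair_fin_digraph G by fact
  obtain v where v: "v \<in> pverts G" using assms(2) by blast
  define \<sigma> where "\<sigma> h = (case h of [] \<Rightarrow> v | x # _ \<Rightarrow> fst x)" for h :: "('a \<times> 'a) list"
  define \<rho> where "\<rho> h c = (case h of [] \<Rightarrow> v | x # _ \<Rightarrow> snd x)" for h :: "('a \<times> 'a) list" and c :: 'a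
  have \<sigma>: "legal_cop G \<sigma>" using v by (simp add: legal_cop_def \<sigma>_def moves_def)
  have "legal_robber G \<rho>" using v by (simp add: legal_robber_def \<rho>_def moves_def)
  then have zero: "robber_guarantees G 0" unfolding robber_guarantees_def by auto
  have bound: "k \<le> card (pverts G)" if guar: "robber_guarantees G k" for k
  proof -
    obtain \<rho>' where \<rho>': "legal_robber G \<rho>'" and "k \<le> card (damaged \<sigma> \<rho>')"
      using guar \<sigma> unfolding robber_guarantees_def by blast
    moreover have "damaged \<sigma> \<rho>' \<subseteq> pverts G"
      using robber_pos_in_verts[OF pair_wf_digraph_axioms \<rho>'] by (auto simp: damaged_def)
    ultimately show ?thesis using card_mono[OF pair_finite_verts] le_trans by blast
  qed
  show "robber_guarantees G (dmg G)"
    unfolding dmg_def using GreatestI_nat[where P = "robber_guarantees G", OF zero bound] .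
  show "robber_guarantees G k \<Longrightarrow> k \<le> dmg G"
    unfolding dmg_def using Greatest_le_nat[where P = "robber_guarantees G", OF _ bound] .
qed

end

theory Submission
  imports Defs
begin

text \<open>
  The game on the incidence graph comes down to one local fact. The graph has girth six and minimum
  degree \<open>q + 1 \<ge> 3\<close>, so a cop standing anywhere but on the robber can forbid him at most one of his
  neighbours: the robber is never caught against his will, but a single undamaged neighbour can be
  denied to him at every move.

  The robber's bound. Let him always go to the safe neighbour that he has visited least
  often so far (\<open>least_visited_strategy_evades\<close>), and let \<open>V\<close> be the set of vertices that he visits only
  finitely often. A vertex outside \<open>V\<close> is visited infinitely often. If it had two neighbours in \<open>V\<close>,
  one of them would be safe at each of these visits. Its visit count stays bounded while the counts outside
  \<open>V\<close> grow without limit, so the robber would enter \<open>V\<close> again and again, which is impossible. Hence \<open>V\<close>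
  is a proper subset closed under joining points and intersecting lines, and everything outside \<open>V\<close> is
  damaged. It remains to see how large such a closed configuration can be. If it has at least \<open>q + 3\<close>
  points it contains a quadrangle, so it is a proper subplane, of order \<open>n\<close> say, and a counting
  argument of Bruck leaves only \<open>n\<^sup>2 = q\<close> for it to be that large. So it is a Baer subplane, with \<open>2 (q + \<surd>q + 1)\<close>
  points and lines, or it has at most \<open>2 q + 4\<close> points and lines together
  (\<open>large_closed_is_Baer\<close>).

  The cop's bound. Suppose that every vertex outside a set \<open>S\<close> has exactly one neighbour
  in \<open>S\<close>. Once the cop shares with the robber that neighbour, he can do so after each of his later
  moves, because any two lines meet and any two points are joined; and then the robber is caught as soon as he enters \<open>S\<close>
  (\<open>cop_guards_tight\<close>). Two kinds of sets have this property: a point \<open>x\<close> and a line \<open>l\<close> not through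
  it, with all points of \<open>l\<close> and all lines through \<open>x\<close> (\<open>2 q + 4\<close> vertices), and a Baer
  subplane. The cop starts on a line \<open>j\<close> and picks \<open>S\<close> only after the robber has chosen his starting vertex.
  He needs \<open>S\<close> to avoid that vertex and, if the vertex is a line, to contain the point in which it
  meets \<open>j\<close>. Sets of the first kind can always be placed like this; for a Baer subplane this is where
  double transitivity is used.
\<close>

section \<open>Counting in planes\<close>

context finite_projective_plane
begin

lemma join_unique:
  assumes "x \<in> P" "y \<in> P" "x \<noteq> y" "l \<in> L" "m \<in> L" "I x l" "I y l" "I x m" "I y m"
  shows "l = m"
  using points_join[OF assms(1-3)] assms by blast

text \<open>Projection from \<open>p\<close> onto \<open>l\<close>.\<close>

lemma card_points_eq_card_lines:
  assumes "l \<in> L" "p \<in> P" "\<not> I p l"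
  shows "card {x \<in> P. I x l} = card {m \<in> L. I p m}"
proof (rule antisym)
  show "card {x \<in> P. I x l} \<le> card {m \<in> L. I p m}"
  proof (rule card_le_if_inj_on_rel[where r = I])
    show "finite {m \<in> L. I p m}" using finite_lines by simp
  next
    fix x assume "x \<in> {x \<in> P. I x l}"
    then show "\<exists>m. m \<in> {m \<in> L. I p m} \<and> I x m"
      using points_join[of x p] assms by blast
  next
    fix x y m assume "x \<in> {x \<in> P. I x l}" "y \<in> {x \<in> P. I x l}" "m \<in> {m \<in> L. I p m}" "I x m" "I y m"
    then show "x = y" using join_unique[of x y l m] assms by auto
  qed
next
  show "card {m \<in> L. I p m} \<le> card {x \<in> P. I x l}"
  proof (rule card_le_if_inj_on_rel[where r = "\<lambda>m x. I x m"])
    show "finite {x \<in> P. I x l}" using finite_points by simp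
  next
    fix m assume "m \<in> {m \<in> L. I p m}"
    then show "\<exists>x. x \<in> {x \<in> P. I x l} \<and> I x m"
      using lines_meet[of m l] assms by blast
  next
    fix k m x assume "k \<in> {m \<in> L. I p m}" "m \<in> {m \<in> L. I p m}" "x \<in> {x \<in> P. I x l}" "I x k" "I x m"
    then show "k = m" using join_unique[of x p k m] assms by auto
  qed
qed

lemma quadrangle_points:
  obtains a b c d where "a \<in> P" "b \<in> P" "c \<in> P" "d \<in> P" "distinct [a, b, c, d]"
    and "\<And>l x y z. \<lbrakk>l \<in> L; {x, y, z} \<subseteq> {a, b, c, d}; distinct [x, y, z]; I x l; I y l\<rbrakk> \<Longrightarrow> \<not> I z l"
proof -
  obtain Q where Q: "Q \<subseteq> P" "card Q = 4" "\<forall>l\<in>L. card {x \<in> Q. I x l} \<le> 2"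
    using quadrangle by blast
  obtain a b c d where abcd: "Q = {a, b, c, d}" "distinct [a, b, c, d]"
    using Q(2) by (auto simp: card_Suc_eq numeral_eq_Suc)
  have "\<not> I z l" if "l \<in> L" "{x, y, z} \<subseteq> {a, b, c, d}" "distinct [x, y, z]" "I x l" "I y l" for l x y z
  proof
    assume "I z l"
    have "card {x, y, z} \<le> card {x \<in> Q. I x l}"
      by (rule card_mono) (use that abcd \<open>I z l\<close> in auto)
    moreover have "card {x, y, z} = 3" using that by auto
    ultimately show False using Q(3) that(1) by fastforce
  qed
  then show thesis using that[of a b c d] abcd Q(1) by blast
qed

text \<open>
  By projection, the degree of a point equals the size of any line missing it. Any two points of the
  quadrangle are missed by the line through the other two, so all four have the same degree. Every line misses one
  of the four, and every point is missed by a side of the triangle \<open>a b c\<close>, so this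
  common degree spreads to all lines and all points.
\<close>

lemma order_exists: "\<exists>n. has_order P L I n"
proof -
  obtain a b c d where pts: "a \<in> P" "b \<in> P" "c \<in> P" "d \<in> P" and dist: "distinct [a, b, c, d]"
    and no3: "\<And>l x y z. \<lbrakk>l \<in> L; {x, y, z} \<subseteq> {a, b, c, d}; distinct [x, y, z]; I x l; I y l\<rbrakk> \<Longrightarrow> \<not> I z l"
    using quadrangle_points by blast
  define deg where "deg x = card {m \<in> L. I x m}" for x
  define size where "size l = card {x \<in> P. I x l}" for l
  have size_deg: "size l = deg p" if "l \<in> L" "p \<in> P" "\<not> I p l" for l p
    using card_points_eq_card_lines that by (simp add: deg_def size_def)
  have same: "deg x = deg y"
    if "x \<in> {a,b,c,d}" "y \<in> {a,b,c,d}" "u \<in> {a,b,c,d}" "v \<in> {a,b,c,d}" "distinct [x, y, u, v]" for x y u v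
  proof -
    have "u \<in> P" "v \<in> P" "u \<noteq> v" using that pts by auto
    then obtain l where l: "l \<in> L" "I u l" "I v l"
      using points_join[of u v] by blast
    have "\<not> I x l" "\<not> I y l" using no3[OF l(1) _ _ l(2,3)] that by auto
    moreover have "x \<in> P" "y \<in> P" using that pts by auto
    ultimately show ?thesis using size_deg[OF l(1)] by metis
  qed
  have degQ: "deg x = deg a" if "x \<in> {a,b,c,d}" for x
    using that same[of b a c d] same[of c a b d] same[of d a b c] dist by auto
  have sizeL: "size l = deg a" if l: "l \<in> L" for l
  proof -
    obtain x where "x \<in> {a,b,c}" "\<not> I x l"
      using no3[OF l, of a b c] dist by auto
    then show ?thesis using size_deg[OF l, of x] degQ[of x] pts by auto
  qed
  have degP: "deg x = deg a" if x: "x \<in> P" for x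
  proof -
    have ne: "a \<noteq> b" "a \<noteq> c" "b \<noteq> c" using dist by auto
    obtain k where k: "k \<in> L" "I a k" "I b k" using points_join[of a b] pts ne by blast
    obtain l where l: "l \<in> L" "I a l" "I c l" using points_join[of a c] pts ne by blast
    obtain m where m: "m \<in> L" "I b m" "I c m" using points_join[of b c] pts ne by blast
    have "\<not> I c k" "\<not> I a m" using no3[OF k(1), of a b c] no3[OF m(1), of b c a] dist k m by auto
    then have "\<not> I x k \<or> \<not> I x l \<or> \<not> I x m"
      using join_unique[of x a k l] k l pts x by blast
    then obtain j where "j \<in> L" "\<not> I x j" using k l m by blast
    then show ?thesis using size_deg[of j x] sizeL[of j] x by simp
  qed
  have "{m \<in> L. I a m} \<noteq> {}" using points_join[of a b] pts dist by auto
  then have "deg a \<noteq> 0" using finite_lines by (auto simp: deg_def)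
  then have "has_order P L I (deg a - 1)"
    using sizeL degP unfolding has_order_def size_def deg_def by auto
  then show ?thesis ..
qed

lemma order_ge_2:
  assumes "has_order P L I n"
  shows "2 \<le> n"
proof -
  obtain a b c d where pts: "a \<in> P" "b \<in> P" "c \<in> P" "d \<in> P" and dist: "distinct [a, b, c, d]"
    and no3: "\<And>l x y z. \<lbrakk>l \<in> L; {x, y, z} \<subseteq> {a, b, c, d}; distinct [x, y, z]; I x l; I y l\<rbrakk> \<Longrightarrow> \<not> I z l"
    using quadrangle_points by blast
  have "card {b, c, d} \<le> card {l \<in> L. I a l}"
  proof (rule card_le_if_inj_on_rel[where r = I])
    show "finite {l \<in> L. I a l}" using finite_lines by simp
  next
    fix x assume "x \<in> {b, c, d}"
    then show "\<exists>l. l \<in> {l \<in> L. I a l} \<and> I x l"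
      using points_join[of x a] pts dist by auto
  next
    fix x y l assume "x \<in> {b, c, d}" "y \<in> {b, c, d}" "l \<in> {l \<in> L. I a l}" "I x l" "I y l"
    then show "x = y" using no3[of l x y a] dist by auto
  qed
  then show ?thesis using assms pts dist by (auto simp: has_order_def)
qed

end

text \<open>
  The quadrangle axiom is replaced by the order being at least two, which makes the axioms
  symmetric in points and lines: every fact below also holds with the two exchanged, by \<open>dual\<close>.
\<close>

locale plane_of_order =
  fixes P :: "'p set" and L :: "'l set" and I :: "'p \<Rightarrow> 'l \<Rightarrow> bool" and q :: nat
  assumes finite_P: "finite P" and finite_L: "finite L"
    and nonempty_P: "P \<noteq> {}" and nonempty_L: "L \<noteq> {}"
    and lines_meet: "\<lbrakk>l \<in> L; m \<in> L; l \<noteq> m\<rbrakk> \<Longrightarrow> \<exists>!x. x \<in> P \<and> I x l \<and> I x m"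
    and points_join: "\<lbrakk>x \<in> P; y \<in> P; x \<noteq> y\<rbrakk> \<Longrightarrow> \<exists>!l. l \<in> L \<and> I x l \<and> I y l"
    and order: "has_order P L I q"
    and order_ge_2: "2 \<le> q"
begin

lemma dual: "plane_of_order L P (\<lambda>l x. I x l) q"
proof
  show "has_order L P (\<lambda>l x. I x l) q" using order by (simp add: has_order_def conj_commute)
qed (use finite_P finite_L nonempty_P nonempty_L lines_meet points_join order_ge_2 in \<open>auto\<close>)

lemma card_points_on: "l \<in> L \<Longrightarrow> card {x \<in> P. I x l} = q + 1"
  using order by (simp add: has_order_def)

lemma card_lines_through: "x \<in> P \<Longrightarrow> card {l \<in> L. I x l} = q + 1"
  using order by (simp add: has_order_def)

lemma join_unique:
  assumes "x \<in> P" "y \<in> P" "x \<noteq> y" "l \<in> L" "m \<in> L" "I x l" "I y l" "I x m" "I y m"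
  shows "l = m"
  using points_join[OF assms(1-3)] assms by blast

lemma common_line:
  assumes "x \<in> P" "y \<in> P" obtains l where "l \<in> L" "I x l" "I y l"
proof (cases "x = y")
  case True
  have "{l \<in> L. I x l} \<noteq> {}" using card_lines_through[OF assms(1)] by (metis card.empty add_is_0 one_neq_zero)
  then show ?thesis using that True by auto
next
  case False
  then show ?thesis using points_join[OF assms] that by auto
qed

lemma card_points: "card P = q\<^sup>2 + q + 1"
proof -
  obtain x where x: "x \<in> P" using nonempty_P by blast
  let ?X = "\<lambda>l. {y \<in> P. I y l} - {x}"
  have "P - {x} = (\<Union>l\<in>{l \<in> L. I x l}. ?X l)"
    using points_join[OF x] by blast
  also have "card \<dots> = (\<Sum>l\<in>{l \<in> L. I x l}. card (?X l))"
  proof (rule card_UN_disjoint)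
    show "\<forall>l\<in>{l \<in> L. I x l}. \<forall>m\<in>{l \<in> L. I x l}. l \<noteq> m \<longrightarrow> ?X l \<inter> ?X m = {}"
      using join_unique[OF x] by blast
  qed (use finite_P finite_L in auto)
  also have "\<dots> = (\<Sum>l\<in>{l \<in> L. I x l}. q)"
    by (rule sum.cong) (use x card_points_on in auto)
  also have "\<dots> = (q + 1) * q" using card_lines_through[OF x] by simp
  finally have "card (P - {x}) = (q + 1) * q" .
  moreover have "card P = Suc (card (P - {x}))" using x finite_P by (metis card_Suc_Diff1)
  ultimately show ?thesis by (simp add: power2_eq_square algebra_simps)
qed

lemma card_lines: "card L = q\<^sup>2 + q + 1"
  using plane_of_order.card_points[OF dual] .

lemma common_point:
  assumes "l \<in> L" "m \<in> L" obtains x where "x \<in> P" "I x l" "I x m"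
  using plane_of_order.common_line[OF dual assms] by blast

end

lemma (in finite_projective_plane) plane_of_orderI:
  assumes "has_order P L I n"
  shows "plane_of_order P L I n"
proof -
  obtain a b where ab: "a \<in> P" "b \<in> P" "a \<noteq> b"
    by (rule quadrangle_points) auto
  then obtain l where "l \<in> L" using points_join by blast
  then show ?thesis using ab
    by unfold_locales (use finite_points finite_lines lines_meet points_join assms order_ge_2[OF assms] in auto)
qed

section \<open>Closed configurations\<close>

text \<open>
  In terms of the incidence graph: a vertex outside the configuration has at most one neighbour in it.
  Equivalently, the configuration contains the joining line of any two of its points and the meeting point of any
  two of its lines.
\<close>

definition closed_configuration ::
    "'p set \<Rightarrow> 'l set \<Rightarrow> ('p \<Rightarrow> 'l \<Rightarrow> bool) \<Rightarrow> 'p set \<Rightarrow> 'l set \<Rightarrow> bool" where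
  "closed_configuration P L I A B \<longleftrightarrow> A \<subseteq> P \<and> B \<subseteq> L \<and>
     (\<forall>x\<in>P - A. \<forall>l\<in>B. \<forall>m\<in>B. I x l \<and> I x m \<longrightarrow> l = m) \<and>
     (\<forall>l\<in>L - B. \<forall>x\<in>A. \<forall>y\<in>A. I x l \<and> I y l \<longrightarrow> x = y)"

lemma closed_configuration_dual:
  "closed_configuration P L I A B \<Longrightarrow> closed_configuration L P (\<lambda>l x. I x l) B A"
  unfolding closed_configuration_def by blast

context plane_of_order
begin

lemma card_le_2_of_opposite_pairs:
  assumes "l \<in> L" "m \<in> L" "x \<in> P" "y \<in> P" "z \<in> P" "w \<in> P" "x \<noteq> y" "z \<noteq> w"
    and "I x l" "I y l" "\<not> I z l" "\<not> I w l" "I z m" "I w m" "\<not> I x m" "\<not> I y m"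
    and k: "k \<in> L"
  shows "card {v \<in> {x, y, z, w}. I v k} \<le> 2"
proof -
  let ?K = "{v \<in> {x, y, z, w}. I v k}"
  have "\<exists>u v. ?K \<subseteq> {u, v}"
  proof (cases "I x k \<and> I y k")
    case True
    then have "k = l" using join_unique[of x y k l] assms by blast
    then have "?K \<subseteq> {x, y}" using assms by auto
    then show ?thesis by blast
  next
    case xy: False
    show ?thesis
    proof (cases "I z k \<and> I w k")
      case True
      then have "k = m" using join_unique[of z w k m] assms by blast
      then have "?K \<subseteq> {z, w}" using assms by auto
      then show ?thesis by blast
    next
      case False
      then have "?K \<subseteq> {if I x k then x else y, if I z k then z else w}" using xy by auto
      then show ?thesis by blast
    qed
  qed
  then obtain u v where "?K \<subseteq> {u, v}" by blast
  then have "card ?K \<le> card {u, v}" by (intro card_mono) auto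
  also have "\<dots> \<le> 2" by (simp add: card_insert_if)
  finally show ?thesis .
qed

text \<open>
  A line has only \<open>q + 1\<close> points, so at least two points of \<open>A\<close> lie off any given line. Take a line \<open>l\<close>
  through \<open>u, v \<in> A\<close>, two points \<open>z, w \<in> A\<close> off \<open>l\<close>, and the line \<open>m\<close> joining \<open>z\<close> and \<open>w\<close>. Either \<open>u, v, z, w\<close> is a
  quadrangle, or \<open>m\<close> contains three points of \<open>A\<close>. In the latter case, any two points \<open>x, y \<in> A\<close> off \<open>m\<close> form a
  quadrangle with two of these three, since the line joining \<open>x\<close> and \<open>y\<close> meets \<open>m\<close> only once.
\<close>

lemma quadrangle_in_large_set:
  assumes A: "A \<subseteq> P" "q + 3 \<le> card A"
  shows "\<exists>Q\<subseteq>A. card Q = 4 \<and> (\<forall>l\<in>L. card {x \<in> Q. I x l} \<le> 2)"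
proof -
  have finA: "finite A" using A(1) finite_P finite_subset by blast
  have off: "\<exists>z\<in>A. \<exists>w\<in>A. z \<noteq> w \<and> \<not> I z l \<and> \<not> I w l" if l: "l \<in> L" for l
  proof -
    have "card A - card {x \<in> P. I x l} \<le> card (A - {x \<in> P. I x l})"
      by (rule diff_card_le_card_Diff) (simp add: finite_P)
    then have "2 \<le> card (A - {x \<in> P. I x l})" using A(2) card_points_on[OF l] by simp
    then obtain T where "T \<subseteq> A - {x \<in> P. I x l}" "card T = 2"
      using obtain_subset_with_card_n by metis
    then show ?thesis using A(1) by (auto simp: card_2_iff)
  qed
  have build: "\<exists>Q\<subseteq>A. card Q = 4 \<and> (\<forall>l\<in>L. card {x \<in> Q. I x l} \<le> 2)"
    if h: "l \<in> L" "m \<in> L" "x \<in> A" "y \<in> A" "z \<in> A" "w \<in> A" "x \<noteq> y" "z \<noteq> w"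
      "I x l" "I y l" "\<not> I z l" "\<not> I w l" "I z m" "I w m" "\<not> I x m" "\<not> I y m" for l m x y z w
  proof (intro exI conjI ballI)
    show "{x, y, z, w} \<subseteq> A" using h by auto
    have "x \<noteq> z" "x \<noteq> w" "y \<noteq> z" "y \<noteq> w" using h by auto
    then show "card {x, y, z, w} = 4" using h by auto
    show "card {v \<in> {x, y, z, w}. I v k} \<le> 2" if k: "k \<in> L" for k
      by (rule card_le_2_of_opposite_pairs[of l m]) (use h k A(1) in auto)
  qed
  obtain l0 where "l0 \<in> L" using nonempty_L by blast
  then obtain u v where uv: "u \<in> A" "v \<in> A" "u \<noteq> v" using off by blast
  then obtain l where l: "l \<in> L" "I u l" "I v l" using points_join[of u v] A(1) by blast
  obtain z w where zw: "z \<in> A" "w \<in> A" "z \<noteq> w" "\<not> I z l" "\<not> I w l" using off[OF l(1)] by blast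
  then obtain m where m: "m \<in> L" "I z m" "I w m" using points_join[of z w] A(1) by blast
  show ?thesis
  proof (cases "I u m \<or> I v m")
    case False
    then show ?thesis using build[of l m u v z w] l m uv zw by blast
  next
    case True
    then obtain t where t: "t \<in> A" "I t m" "t \<noteq> z" "t \<noteq> w" using uv l zw by blast
    obtain x y where xy: "x \<in> A" "y \<in> A" "x \<noteq> y" "\<not> I x m" "\<not> I y m" using off[OF m(1)] by blast
    then obtain k where k: "k \<in> L" "I x k" "I y k" using points_join[of x y] A(1) by blast
    have "m \<noteq> k" using k xy by blast
    then have one: "a = b" if "a \<in> A" "b \<in> A" "I a k" "I b k" "I a m" "I b m" for a b
      using join_unique[of a b m k] that A(1) m(1) k(1) by blast
    obtain a b where "a \<in> {z, w, t}" "b \<in> {z, w, t}" "a \<noteq> b" "\<not> I a k" "\<not> I b k"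
      using one[of z w] one[of z t] one[of w t] zw t m by blast
    then show ?thesis using build[of m k a b x y] k m xy t zw by blast
  qed
qed

lemma closed_finite_projective_plane:
  assumes cl: "closed_configuration P L I A B" and big: "q + 3 \<le> card A"
  shows "finite_projective_plane A B I"
proof
  have AB: "A \<subseteq> P" "B \<subseteq> L"
    and clP: "\<And>x l m. \<lbrakk>x \<in> P; x \<notin> A; l \<in> B; m \<in> B; I x l; I x m\<rbrakk> \<Longrightarrow> l = m"
    and clL: "\<And>l x y. \<lbrakk>l \<in> L; l \<notin> B; x \<in> A; y \<in> A; I x l; I y l\<rbrakk> \<Longrightarrow> x = y"
    using cl unfolding closed_configuration_def by blast+
  show "finite A" "finite B" using AB finite_P finite_L finite_subset by blast+
  show "\<exists>!x. x \<in> A \<and> I x l \<and> I x m" if lm: "l \<in> B" "m \<in> B" "l \<noteq> m" for l m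
  proof -
    have "l \<in> L" "m \<in> L" using lm AB by blast+
    then obtain x where x: "x \<in> P" "I x l" "I x m" and uniq: "\<And>y. \<lbrakk>y \<in> P; I y l; I y m\<rbrakk> \<Longrightarrow> y = x"
      using lines_meet[of l m] lm(3) by metis
    have "x \<in> A" using clP[of x l m] x lm by blast
    then show ?thesis using x uniq AB by blast
  qed
  show "\<exists>!l. l \<in> B \<and> I x l \<and> I y l" if xy: "x \<in> A" "y \<in> A" "x \<noteq> y" for x y
  proof -
    have "x \<in> P" "y \<in> P" using xy AB by blast+
    then obtain l where l: "l \<in> L" "I x l" "I y l" and uniq: "\<And>m. \<lbrakk>m \<in> L; I x m; I y m\<rbrakk> \<Longrightarrow> m = l"
      using points_join[of x y] xy(3) by metis
    have "l \<in> B" using clL[of l x y] l xy by blast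
    then show ?thesis using l uniq AB by blast
  qed
  show "\<exists>Q\<subseteq>A. card Q = 4 \<and> (\<forall>l\<in>B. card {x \<in> Q. I x l} \<le> 2)"
    using quadrangle_in_large_set[OF AB(1) big] AB(2) by blast
qed

text \<open>
  The lines of the configuration meet \<open>k\<close> in points outside the configuration, hence in distinct
  ones.
\<close>

lemma closed_lines_le_if_missed:
  assumes cl: "closed_configuration P L I A B" and k: "k \<in> L" and none: "\<And>x. x \<in> A \<Longrightarrow> \<not> I x k"
  shows "card B \<le> q + 1"
proof -
  have "card B \<le> card {x \<in> P. I x k}"
  proof (rule card_le_if_inj_on_rel[where r = "\<lambda>l x. I x l"])
    fix l assume "l \<in> B"
    then have "l \<in> L" using cl by (auto simp: closed_configuration_def)
    then show "\<exists>x. x \<in> {x \<in> P. I x k} \<and> I x l" using common_point[OF _ k] by blast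
  next
    fix l m x assume "l \<in> B" "m \<in> B" "x \<in> {x \<in> P. I x k}" "I x l" "I x m"
    then show "l = m" using cl none unfolding closed_configuration_def by blast
  qed (simp add: finite_P)
  then show ?thesis using card_points_on[OF k] by simp
qed

text \<open>
  The extremal case of Bruck's theorem on the orders of subplanes. As the subplane has more than
  \<open>q + 1\<close> lines, it meets every line. Choose a line \<open>l\<close> of the subplane and a point \<open>x\<close> of \<open>l\<close>
  outside the subplane. Each of the \<open>q\<close> other lines through \<open>x\<close> then contains exactly one point of the subplane,
  and these are the \<open>n\<^sup>2\<close> points off \<open>l\<close>.
\<close>

lemma Bruck:
  assumes cl: "closed_configuration P L I A B" and sub: "plane_of_order A B I n"
    and "n < q" and big: "q + 1 < card B"
  shows "n\<^sup>2 = q"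
proof -
  interpret S: plane_of_order A B I n by (rule sub)
  have AB: "A \<subseteq> P" "B \<subseteq> L"
    and clP: "\<And>x l m. \<lbrakk>x \<in> P; x \<notin> A; l \<in> B; m \<in> B; I x l; I x m\<rbrakk> \<Longrightarrow> l = m"
    and clL: "\<And>l x y. \<lbrakk>l \<in> L; l \<notin> B; x \<in> A; y \<in> A; I x l; I y l\<rbrakk> \<Longrightarrow> x = y"
    using cl unfolding closed_configuration_def by blast+
  have met: "\<exists>x\<in>A. I x k" if "k \<in> L" for k
    using closed_lines_le_if_missed[OF cl that] big by fastforce
  obtain l where l: "l \<in> B" using S.nonempty_L by blast
  then have lL: "l \<in> L" using AB by blast
  have "card {x \<in> A. I x l} < card {x \<in> P. I x l}"
    using S.card_points_on[OF l] card_points_on[OF lL] \<open>n < q\<close> by simp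
  then have "\<not> {x \<in> P. I x l} \<subseteq> {x \<in> A. I x l}"
    using S.finite_P card_mono[of "{x \<in> A. I x l}" "{x \<in> P. I x l}"] by fastforce
  then obtain x where x: "x \<in> P" "I x l" "x \<notin> A" by blast
  let ?X = "A - {y \<in> A. I y l}" and ?Y = "{k \<in> L. I x k} - {l}"
  have "card ?X = n\<^sup>2"
    using card_Diff_subset[of "{y \<in> A. I y l}" A] S.finite_P S.card_points S.card_points_on[OF l] by simp
  moreover have "card ?Y = q"
    using card_Diff_singleton[of l "{k \<in> L. I x k}"] x lL card_lines_through[OF x(1)] by simp
  moreover have "card ?X \<le> card ?Y"
  proof (rule card_le_if_inj_on_rel[where r = I])
    fix y assume "y \<in> ?X"
    then show "\<exists>k. k \<in> ?Y \<and> I y k" using points_join[of x y] x AB by blast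
  next
    fix y z k assume "y \<in> ?X" "z \<in> ?X" "k \<in> ?Y" "I y k" "I z k"
    then show "y = z" using clP[OF x(1,3) l, of k] clL[of k y z] x by blast
  qed (simp add: finite_L)
  moreover have "card ?Y \<le> card ?X"
  proof (rule card_le_if_inj_on_rel[where r = "\<lambda>k y. I y k"])
    fix k assume k: "k \<in> ?Y"
    then obtain y where y: "y \<in> A" "I y k" using met by blast
    then have "\<not> I y l" using join_unique[of x y k l] x k lL AB by blast
    then show "\<exists>y. y \<in> ?X \<and> I y k" using y by blast
  next
    fix k m y assume "k \<in> ?Y" "m \<in> ?Y" "y \<in> ?X" "I y k" "I y m"
    then show "k = m" using join_unique[of x y k m] x AB by blast
  qed (simp add: S.finite_P)
  ultimately show ?thesis by simp
qed

text \<open>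
  The configuration is a subplane of order \<open>n \<le> q\<close>. Equality would make it the whole plane, and
  \<open>n < q\<close> is the situation of Bruck's argument.
\<close>

lemma many_points_closed_is_Baer:
  assumes cl: "closed_configuration P L I A B" and big: "q + 3 \<le> card A"
    and proper: "A \<noteq> P \<or> B \<noteq> L"
  obtains n where "n\<^sup>2 = q" "plane_of_order A B I n" "finite_projective_plane A B I"
proof -
  have fpp: "finite_projective_plane A B I" by (rule closed_finite_projective_plane[OF cl big])
  then obtain n where n: "has_order A B I n" using finite_projective_plane.order_exists by blast
  have sub: "plane_of_order A B I n" by (rule finite_projective_plane.plane_of_orderI[OF fpp n])
  interpret S: plane_of_order A B I n by (rule sub)
  have AB: "A \<subseteq> P" "B \<subseteq> L" using cl by (auto simp: closed_configuration_def)
  obtain l where l: "l \<in> B" using S.nonempty_L by blast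
  have "card {x \<in> A. I x l} \<le> card {x \<in> P. I x l}"
    by (rule card_mono) (use AB finite_P in auto)
  then have "n \<le> q" using S.card_points_on[OF l] card_points_on[of l] l AB by auto
  moreover have "n \<noteq> q"
    using card_subset_eq[OF finite_P AB(1)] card_subset_eq[OF finite_L AB(2)] proper
      S.card_points S.card_lines card_points card_lines by auto
  ultimately have "n < q" by simp
  moreover have "q + 1 < card B" using big S.card_points S.card_lines by simp
  ultimately have "n\<^sup>2 = q" by (rule Bruck[OF cl sub])
  then show thesis using that sub fpp by blast
qed

lemma large_closed_is_Baer:
  assumes cl: "closed_configuration P L I A B" and proper: "A \<noteq> P \<or> B \<noteq> L"
    and large: "2 * q + 4 < card A + card B"
  obtains n where "n\<^sup>2 = q" "subplane A B P L I" "has_order A B I n" "card A + card B = 2 * (q + n + 1)"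
proof -
  \<comment> \<open>If there are few points then there are many lines, so the configuration is a subplane of the dual
    plane; but a subplane has as many points as lines.\<close>
  have "q + 3 \<le> card A"
  proof (rule ccontr)
    assume a: "\<not> q + 3 \<le> card A"
    then have "q + 3 \<le> card B" using large by simp
    moreover have "B \<noteq> L \<or> A \<noteq> P" using proper by blast
    ultimately obtain n where "plane_of_order B A (\<lambda>l x. I x l) n"
      using plane_of_order.many_points_closed_is_Baer[OF dual closed_configuration_dual[OF cl]] by metis
    then have "card A = card B"
      using plane_of_order.card_points plane_of_order.card_lines by metis
    then show False using a \<open>q + 3 \<le> card B\<close> by simp
  qed
  then obtain n where n: "n\<^sup>2 = q" "plane_of_order A B I n" "finite_projective_plane A B I"
    using many_points_closed_is_Baer[OF cl _ proper] by blast
  interpret S: plane_of_order A B I n by (rule n(2))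
  have "subplane A B P L I" using n(3) cl by (simp add: subplane_def closed_configuration_def)
  then show thesis using that n(1) S.order S.card_points S.card_lines by simp
qed

end


section \<open>The robber visits the least visited vertices\<close>

lemma history_Suc:
  "history \<sigma> \<rho> (Suc n) = (cop_pos \<sigma> \<rho> n, robber_pos \<sigma> \<rho> n) # history \<sigma> \<rho> n"
  by (simp add: cop_pos_def robber_pos_def Let_def)

lemma cop_pos_0: "cop_pos \<sigma> \<rho> 0 = \<sigma> []"
  by (simp add: cop_pos_def Let_def)

lemma robber_pos_0: "robber_pos \<sigma> \<rho> 0 = \<rho> [] (\<sigma> [])"
  by (simp add: robber_pos_def Let_def)

lemma cop_pos_Suc:
  "cop_pos \<sigma> \<rho> (Suc n) = \<sigma> ((cop_pos \<sigma> \<rho> n, robber_pos \<sigma> \<rho> n) # history \<sigma> \<rho> n)"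
  unfolding history_Suc[symmetric] by (simp add: cop_pos_def Let_def)

lemma robber_pos_Suc:
  "robber_pos \<sigma> \<rho> (Suc n) =
     \<rho> ((cop_pos \<sigma> \<rho> n, robber_pos \<sigma> \<rho> n) # history \<sigma> \<rho> n) (cop_pos \<sigma> \<rho> (Suc n))"
  unfolding cop_pos_Suc unfolding history_Suc[symmetric] by (simp add: robber_pos_def Let_def)

lemma count_robber_positions:
  "count_list (map snd (history \<sigma> \<rho> n)) v = card {k. k < n \<and> robber_pos \<sigma> \<rho> k = v}"
proof (induction n)
  case (Suc n)
  have "{k. k < Suc n \<and> robber_pos \<sigma> \<rho> k = v} =
      {k. k < n \<and> robber_pos \<sigma> \<rho> k = v} \<union> (if robber_pos \<sigma> \<rho> n = v then {n} else {})"
    by (auto simp: less_Suc_eq)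
  then show ?case using Suc by (simp add: history_Suc del: history.simps)
qed simp

text \<open>After a move into this set the cop needs at least two moves to reach the robber.\<close>

definition safe_neighbours :: "'v pair_pre_digraph \<Rightarrow> 'v \<Rightarrow> 'v \<Rightarrow> 'v set" where
  "safe_neighbours G c r = {w. (r, w) \<in> parcs G \<and> w \<notin> moves G c}"

text \<open>
  The default values (any vertex at the start, staying when no neighbour is safe) only serve to make the
  strategy legal on all histories.
\<close>

definition least_visited_strategy :: "'v pair_pre_digraph \<Rightarrow> 'v robber_strategy" where
  "least_visited_strategy G h c = (case h of
     [] \<Rightarrow> if pverts G - moves G c = {} then SOME v. v \<in> pverts G else SOME v. v \<in> pverts G - moves G c
   | (_, r) # _ \<Rightarrow> if safe_neighbours G c r = {} then r
       else ARG_MIN (count_list (map snd h)) w. w \<in> safe_neighbours G c r)"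

lemma least_visited_strategy_Cons:
  assumes "safe_neighbours G c r \<noteq> {}"
  shows "least_visited_strategy G ((c0, r) # h) c \<in> safe_neighbours G c r"
    and "w \<in> safe_neighbours G c r \<Longrightarrow>
      count_list (map snd ((c0, r) # h)) (least_visited_strategy G ((c0, r) # h) c)
        \<le> count_list (map snd ((c0, r) # h)) w"
proof -
  let ?f = "count_list (map snd ((c0, r) # h))"
  have eq: "least_visited_strategy G ((c0, r) # h) c = (ARG_MIN ?f w. w \<in> safe_neighbours G c r)"
    using assms by (simp add: least_visited_strategy_def)
  obtain v where v: "v \<in> safe_neighbours G c r" using assms by blast
  show "least_visited_strategy G ((c0, r) # h) c \<in> safe_neighbours G c r"
    unfolding eq by (rule arg_min_natI[of "\<lambda>w. w \<in> safe_neighbours G c r", OF v])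
  show "?f (least_visited_strategy G ((c0, r) # h) c) \<le> ?f w" if "w \<in> safe_neighbours G c r"
    unfolding eq by (rule arg_min_nat_le[of "\<lambda>w. w \<in> safe_neighbours G c r", OF that])
qed

lemma legal_least_visited_strategy:
  assumes "pverts G \<noteq> {}"
  shows "legal_robber G (least_visited_strategy G)"
  unfolding legal_robber_def
proof (intro conjI allI)
  fix c
  show "least_visited_strategy G [] c \<in> pverts G"
  proof (cases "pverts G - moves G c = {}")
    case True
    then show ?thesis using assms some_in_eq[of "pverts G"] by (simp add: least_visited_strategy_def)
  next
    case False
    then have "(SOME v. v \<in> pverts G - moves G c) \<in> pverts G - moves G c" by (rule some_in_eq[THEN iffD2])
    then show ?thesis using False by (simp add: least_visited_strategy_def)
  qed
next
  fix h :: "('a \<times> 'a) list" and c r c'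
  show "least_visited_strategy G ((c, r) # h) c' \<in> moves G r"
  proof (cases "safe_neighbours G c' r = {}")
    case True
    then show ?thesis by (simp add: least_visited_strategy_def moves_def)
  next
    case False
    then show ?thesis using least_visited_strategy_Cons(1)[OF False]
      by (fastforce simp: safe_neighbours_def moves_def)
  qed
qed

text \<open>
  The set \<open>V\<close> consists of the vertices that the robber visits only finitely often. It is proper
  because the play is infinite and the graph is finite. The assumptions say that the robber has a safe starting vertex, that he
  always has two neighbours, and that the cop can guard at most one neighbour of a vertex other than his own.
\<close>

lemma least_visited_strategy_evades:
  assumes legal: "legal_cop G \<sigma>" and wf: "pair_wf_digraph G" and fin: "finite (pverts G)"
    and start: "\<And>c. c \<in> pverts G \<Longrightarrow> \<not> pverts G \<subseteq> moves G c"
    and escape: "\<And>r. r \<in> pverts G \<Longrightarrow>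
          \<exists>w w'. w \<noteq> w' \<and> (r, w) \<in> parcs G \<and> (r, w') \<in> parcs G"
    and one_guarded: "\<And>c r w w'. \<lbrakk>c \<in> pverts G; c \<noteq> r; (r, w) \<in> parcs G; (r, w') \<in> parcs G;
          w \<in> moves G c; w' \<in> moves G c\<rbrakk> \<Longrightarrow> w = w'"
  defines "\<rho> \<equiv> least_visited_strategy G"
  shows "\<exists>V. V \<subset> pverts G \<and> pverts G - V \<subseteq> damaged \<sigma> \<rho> \<and>
    (\<forall>v \<in> pverts G - V. \<forall>w \<in> V. \<forall>w' \<in> V. (v, w) \<in> parcs G \<and> (v, w') \<in> parcs G \<longrightarrow> w = w')"
proof -
  interpret pair_wf_digraph G by (rule wf)
  define c r where "c n = cop_pos \<sigma> \<rho> n" and "r n = robber_pos \<sigma> \<rho> n" for n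
  have verts_ne: "pverts G \<noteq> {}" using legal by (auto simp: legal_cop_def)
  have r_in: "r n \<in> pverts G" for n
    using robber_pos_in_verts[OF wf legal_least_visited_strategy[OF verts_ne]] by (simp add: r_def \<rho>_def)
  have c_move: "c (Suc n) \<in> moves G (c n)" for n
    using legal by (simp add: c_def cop_pos_Suc legal_cop_def)
  have c_in: "c n \<in> pverts G" for n
  proof (induction n)
    case 0
    then show ?case using legal by (simp add: c_def cop_pos_0 legal_cop_def)
  next
    case (Suc n)
    then show ?case using c_move[of n] in_arcsD2 by (auto simp: moves_def)
  qed
  have safe_ex: "safe_neighbours G d s \<noteq> {}" if "d \<in> pverts G" "s \<in> pverts G" "d \<noteq> s" for d s
    using escape[OF that(2)] one_guarded[OF that(1,3)] by (fastforce simp: safe_neighbours_def)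
  have r_Suc: "r (Suc n) = least_visited_strategy G ((c n, r n) # history \<sigma> \<rho> n) (c (Suc n))" for n
    by (simp add: r_def c_def \<rho>_def robber_pos_Suc)
  have evade: "r n \<notin> moves G (c n)" for n
  proof (induction n)
    case 0
    have ne: "pverts G - moves G (c 0) \<noteq> {}" using start[OF c_in] by blast
    then have "(SOME v. v \<in> pverts G - moves G (c 0)) \<in> pverts G - moves G (c 0)"
      by (rule some_in_eq[THEN iffD2])
    then show ?case using ne by (simp add: c_def r_def robber_pos_0 cop_pos_0 \<rho>_def least_visited_strategy_def)
  next
    case (Suc n)
    then have "c (Suc n) \<noteq> r n" using c_move[of n] by metis
    then show ?case
      using least_visited_strategy_Cons(1)[OF safe_ex[OF c_in r_in]] unfolding r_Suc
      by (simp add: safe_neighbours_def)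
  qed
  have apart: "c (Suc n) \<noteq> r n" for n using c_move[of n] evade[of n] by metis
  have "\<not> captured_in \<sigma> \<rho> n" for n
    using apart evade[of n] by (auto simp: captured_in_def c_def r_def moves_def)
  then have dam: "damaged \<sigma> \<rho> = range r" by (auto simp: damaged_def r_def)
  define V where "V = {v \<in> pverts G. finite {n. r n = v}}"
  have "\<exists>v\<in>pverts G. infinite {n. r n = v}"
    using pigeonhole_infinite[of "UNIV :: nat set" r] r_in finite_subset[OF _ fin, of "range r"] by auto
  then have "V \<subset> pverts G" by (auto simp: V_def)
  moreover have "pverts G - V \<subseteq> damaged \<sigma> \<rho>"
  proof
    fix v assume "v \<in> pverts G - V"
    then have "infinite {n. r n = v}" by (simp add: V_def)
    then have "{n. r n = v} \<noteq> {}" by (metis finite.emptyI)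
    then show "v \<in> damaged \<sigma> \<rho>" by (auto simp: dam)
  qed
  moreover have "w = w'"
    if v: "v \<in> pverts G - V" and w: "w \<in> V" "w' \<in> V" and arcs: "(v, w) \<in> parcs G" "(v, w') \<in> parcs G" for v w w'
  proof (rule ccontr)
    assume ne: "w \<noteq> w'"
    \<comment> \<open>From some time \<open>T\<close> on, no vertex of \<open>V\<close> is visited, and every vertex outside \<open>V\<close> has been visited
      more often than \<open>w\<close> and \<open>w'\<close> ever are. A visit to \<open>v\<close> after time \<open>T\<close> then leads into \<open>V\<close>.\<close>
    define cnt where "cnt n u = card {k. k < n \<and> r k = u}" for n u
    have cnt_mono: "cnt m u \<le> cnt n u" if "m \<le> n" for m n u
      unfolding cnt_def by (rule card_mono) (use that in auto)
    define N where "N = card {k. r k = w} + card {k. r k = w'}"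
    have bounded: "cnt n w \<le> N" "cnt n w' \<le> N" for n
    proof -
      have "cnt n u \<le> card {k. r k = u}" if "u \<in> V" for u
        unfolding cnt_def by (rule card_mono) (use that in \<open>auto simp: V_def\<close>)
      from this[OF w(1)] this[OF w(2)] show "cnt n w \<le> N" "cnt n w' \<le> N" by (auto simp: N_def)
    qed
    have "\<forall>u. \<exists>t. u \<in> pverts G \<longrightarrow> (\<forall>n\<ge>t. if u \<in> V then r n \<noteq> u else N < cnt n u)"
    proof (intro allI)
      fix u
      show "\<exists>t. u \<in> pverts G \<longrightarrow> (\<forall>n\<ge>t. if u \<in> V then r n \<noteq> u else N < cnt n u)"
      proof (cases "finite {n. r n = u}")
        case True
        then obtain t where "\<forall>n. r n = u \<longrightarrow> n < t" by (auto simp: finite_nat_set_iff_bounded)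
        then show ?thesis using True by (intro exI[of _ t]) (fastforce simp: V_def)
      next
        case False
        then obtain K where K: "finite K" "card K = Suc N" "K \<subseteq> {n. r n = u}"
          using infinite_arbitrarily_large by metis
        then obtain t where t: "\<forall>n\<in>K. n < t" by (auto simp: finite_nat_set_iff_bounded)
        have "card K \<le> cnt t u" unfolding cnt_def by (rule card_mono) (use K t in auto)
        then have "N < cnt n u" if "n \<ge> t" for n using K(2) cnt_mono[OF that, of u] by simp
        then show ?thesis using False by (auto simp: V_def)
      qed
    qed
    then obtain t where t: "\<And>u n. \<lbrakk>u \<in> pverts G; t u \<le> n\<rbrakk> \<Longrightarrow> if u \<in> V then r n \<noteq> u else N < cnt n u"
      by metis
    define T where "T = Max (t ` pverts G)"
    have T: "if u \<in> V then r n \<noteq> u else N < cnt n u" if "u \<in> pverts G" "T \<le> n" for u n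
    proof (rule t[OF that(1)])
      have "t u \<le> T" unfolding T_def by (rule Max_ge) (use fin that in auto)
      then show "t u \<le> n" using that(2) by simp
    qed
    have "infinite {n. r n = v}" using v by (simp add: V_def)
    then obtain n where n: "T \<le> n" "r n = v"
      by (auto simp: infinite_nat_iff_unbounded_le)
    have "w \<in> safe_neighbours G (c (Suc n)) v \<or> w' \<in> safe_neighbours G (c (Suc n)) v"
      using one_guarded[OF c_in apart, of n w w'] arcs ne n by (auto simp: safe_neighbours_def)
    then obtain x where x: "x \<in> safe_neighbours G (c (Suc n)) (r n)" "x \<in> {w, w'}" using n by blast
    have cnt_hist: "count_list (map snd ((c n, r n) # history \<sigma> \<rho> n)) u = cnt (Suc n) u" for u
      unfolding c_def r_def cnt_def history_Suc[symmetric] by (rule count_robber_positions)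
    have "cnt (Suc n) (r (Suc n)) \<le> cnt (Suc n) x"
      using least_visited_strategy_Cons(2)[of G "c (Suc n)" "r n" x "c n" "history \<sigma> \<rho> n"] x
      unfolding cnt_hist r_Suc[symmetric] by blast
    also have "\<dots> \<le> N" using bounded x by auto
    finally have "r (Suc n) \<in> V" using T[OF r_in[of "Suc n"], of "Suc n"] n by (auto split: if_splits)
    then show False using T[OF r_in[of "Suc n"], of "Suc n"] n by simp
  qed
  ultimately show ?thesis by blast
qed

section \<open>A cop guarding a set\<close>

text \<open>
  The cop moves so as to restore \<open>R\<close> between his position and that of the robber, and captures
  whenever he can. The invariant is stated for the moment before his move: as long as there is no capture, the robber is
  outside \<open>S\<close> and \<open>R\<close> can be restored. As the cop's strategy may depend on that of the robber, so may \<open>S\<close>.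
\<close>

lemma guarding:
  fixes G :: "'v pair_pre_digraph"
  assumes legal: "legal_robber G \<rho>" and c0: "c0 \<in> pverts G"
    and init: "\<rho> [] c0 \<in> moves G c0 \<or> (\<rho> [] c0 \<notin> S \<and> (\<exists>c\<in>moves G c0. R c (\<rho> [] c0)))"
    and step: "\<And>c r r'. \<lbrakk>R c r; r \<notin> S; r' \<in> moves G r; r' \<notin> S\<rbrakk> \<Longrightarrow> \<exists>c'\<in>moves G c. R c' r'"
    and guard: "\<And>c r s. \<lbrakk>R c r; r \<notin> S; s \<in> moves G r; s \<in> S\<rbrakk> \<Longrightarrow> s \<in> moves G c"
  shows "\<exists>\<sigma>. legal_cop G \<sigma> \<and> damaged \<sigma> \<rho> \<inter> S = {}"
proof (intro exI conjI)
  define \<tau> where "\<tau> c r = (if r \<in> moves G c then r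
      else if \<exists>c'\<in>moves G c. R c' r then SOME c'. c' \<in> moves G c \<and> R c' r else c)" for c r
  define \<sigma> where "\<sigma> h = (case h of [] \<Rightarrow> c0 | (c, r) # _ \<Rightarrow> \<tau> c r)" for h :: "('v \<times> 'v) list"
  have pick: "\<tau> c r \<in> moves G c \<and> R (\<tau> c r) r" if "r \<notin> moves G c" "\<exists>c'\<in>moves G c. R c' r" for c r
    using that someI_ex[of "\<lambda>c'. c' \<in> moves G c \<and> R c' r"] by (auto simp: \<tau>_def)
  have "\<tau> c r \<in> moves G c" for c r
    using pick[of r c] by (auto simp: \<tau>_def moves_def)
  then show "legal_cop G \<sigma>" using c0 by (simp add: legal_cop_def \<sigma>_def)
  define c r where "c n = cop_pos \<sigma> \<rho> n" and "r n = robber_pos \<sigma> \<rho> n" for n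
  have c_Suc: "c (Suc n) = \<tau> (c n) (r n)" for n by (simp add: c_def r_def cop_pos_Suc \<sigma>_def)
  have r_Suc: "r (Suc n) \<in> moves G (r n)" for n
    using legal by (simp add: r_def robber_pos_Suc legal_robber_def)
  have caught: "captured_in \<sigma> \<rho> (Suc n)" if "r n \<in> moves G (c n)" for n
    using that c_Suc[of n] by (auto simp: captured_in_def c_def r_def \<tau>_def)
  have "r n \<notin> S \<and> (\<exists>c'\<in>moves G (c n). R c' (r n))" if "\<forall>m\<le>Suc n. \<not> captured_in \<sigma> \<rho> m" for n
    using that
  proof (induction n)
    case 0
    then have "r 0 \<notin> moves G (c 0)" using caught[of 0] by auto
    then show ?case using init by (simp add: c_def r_def cop_pos_0 robber_pos_0 \<sigma>_def)
  next
    case (Suc n)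
    then have IH: "r n \<notin> S" "\<exists>c'\<in>moves G (c n). R c' (r n)" by auto
    have free: "r n \<notin> moves G (c n)" "r (Suc n) \<notin> moves G (c (Suc n))"
      using caught[of n] caught[of "Suc n"] Suc.prems by auto
    have R: "R (c (Suc n)) (r n)" using pick[OF free(1) IH(2)] by (simp add: c_Suc)
    have "r (Suc n) \<notin> S" using guard[OF R IH(1) r_Suc] free(2) by blast
    then show ?case using step[OF R IH(1) r_Suc] by blast
  qed
  then show "damaged \<sigma> \<rho> \<inter> S = {}" by (auto simp: damaged_def r_def)
qed

section \<open>Tight configurations\<close>

text \<open>
  In terms of the incidence graph: a vertex outside the configuration has exactly one neighbour in it.
\<close>

definition tight_configuration ::
    "'p set \<Rightarrow> 'l set \<Rightarrow> ('p \<Rightarrow> 'l \<Rightarrow> bool) \<Rightarrow> 'p set \<Rightarrow> 'l set \<Rightarrow> bool" where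
  "tight_configuration P L I A B \<longleftrightarrow> A \<subseteq> P \<and> B \<subseteq> L \<and>
     (\<forall>x\<in>P - A. \<exists>!l. l \<in> B \<and> I x l) \<and> (\<forall>l\<in>L - B. \<exists>!x. x \<in> A \<and> I x l)"

lemma tight_configuration_image:
  assumes "plane_automorphism P L I f g" and t: "tight_configuration P L I A B"
  shows "tight_configuration P L I (f ` A) (g ` B)"
    and "card (f ` A) = card A" and "card (g ` B) = card B"
proof -
  have f: "inj_on f P" "f ` P = P" and g: "inj_on g L" "g ` L = L"
    and inc: "\<And>x l. \<lbrakk>x \<in> P; l \<in> L\<rbrakk> \<Longrightarrow> I (f x) (g l) \<longleftrightarrow> I x l"
    using assms(1) unfolding plane_automorphism_def bij_betw_def by blast+
  have AB: "A \<subseteq> P" "B \<subseteq> L" using t by (auto simp: tight_configuration_def)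
  show "card (f ` A) = card A" "card (g ` B) = card B"
    by (rule card_image, rule inj_on_subset[OF f(1) AB(1)])
      (rule card_image, rule inj_on_subset[OF g(1) AB(2)])
  have point: "\<exists>!l. l \<in> g ` B \<and> I y l" if y: "y \<in> P - f ` A" for y
  proof -
    obtain x where x: "x \<in> P - A" "y = f x" using y f(2) by blast
    then have "\<exists>!l. l \<in> B \<and> I x l" using t unfolding tight_configuration_def by blast
    then obtain l where l: "l \<in> B" "I x l" and uniq: "\<And>m. \<lbrakk>m \<in> B; I x m\<rbrakk> \<Longrightarrow> m = l" by auto
    show ?thesis
    proof (rule ex1I[of _ "g l"])
      show "g l \<in> g ` B \<and> I y (g l)" using l x AB inc[of x l] by auto
      show "m = g l" if my: "m \<in> g ` B \<and> I y m" for m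
      proof -
        obtain k where k: "k \<in> B" "m = g k" using my by blast
        then have "I x k" using my x AB inc[of x k] by auto
        then show ?thesis using uniq[of k] k by simp
      qed
    qed
  qed
  have line: "\<exists>!x. x \<in> f ` A \<and> I x m" if m: "m \<in> L - g ` B" for m
  proof -
    have "m \<in> g ` L" using m g(2) by simp
    then obtain l where l: "l \<in> L - B" "m = g l" using m by blast
    then have "\<exists>!x. x \<in> A \<and> I x l" using t unfolding tight_configuration_def by blast
    then obtain x where x: "x \<in> A" "I x l" and uniq: "\<And>y. \<lbrakk>y \<in> A; I y l\<rbrakk> \<Longrightarrow> y = x" by auto
    show ?thesis
    proof (rule ex1I[of _ "f x"])
      show "f x \<in> f ` A \<and> I (f x) m" using l x AB inc[of x l] by auto
      show "y = f x" if ym: "y \<in> f ` A \<and> I y m" for y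
      proof -
        obtain z where z: "z \<in> A" "y = f z" using ym by blast
        then have "I z l" using ym l AB inc[of z l] by auto
        then show ?thesis using uniq[of z] z by simp
      qed
    qed
  qed
  have "f ` A \<subseteq> P" "g ` B \<subseteq> L" using AB f(2) g(2) by blast+
  then show "tight_configuration P L I (f ` A) (g ` B)"
    unfolding tight_configuration_def by (intro conjI ballI point line)
qed

context plane_of_order
begin

text \<open>
  For a point \<open>y\<close> outside, the line is the one joining it to \<open>x\<close>; for a line outside, the point is
  its intersection with \<open>l\<close>.
\<close>

lemma antiflag_tight:
  assumes "x \<in> P" "l \<in> L" "\<not> I x l"
  defines "A \<equiv> insert x {y \<in> P. I y l}" and "B \<equiv> insert l {m \<in> L. I x m}"
  shows "tight_configuration P L I A B" "card A + card B = 2 * q + 4"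
proof -
  have "\<exists>!m. m \<in> B \<and> I y m" if "y \<in> P - A" for y
    using points_join[of x y] that assms by (auto simp: A_def B_def)
  moreover have "\<exists>!y. y \<in> A \<and> I y m" if "m \<in> L - B" for m
    using lines_meet[of l m] that assms by (auto simp: A_def B_def)
  ultimately show "tight_configuration P L I A B"
    using assms by (auto simp: tight_configuration_def A_def B_def)
  show "card A + card B = 2 * q + 4"
    using assms finite_P finite_L card_points_on card_lines_through by (simp add: A_def B_def)
qed

text \<open>
  If a line \<open>l\<close> contained no point of the subplane, the \<open>q + r + 1\<close> lines of the subplane would meet it in
  distinct points, more than the \<open>q + 1\<close> points of \<open>l\<close>. The dual argument applies to points.
\<close>

lemma Baer_tight:
  assumes sub: "A \<subseteq> P" "B \<subseteq> L" "plane_of_order A B I r" and r: "r\<^sup>2 = q"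
  shows "tight_configuration P L I A B" "card A + card B = 2 * (q + r + 1)"
proof -
  interpret S: plane_of_order A B I r by (rule sub)
  have r_pos: "r \<noteq> 0" using S.order_ge_2 by simp
  have line: "\<exists>x\<in>A. I x l" if l: "l \<in> L - B" for l
  proof (rule ccontr)
    assume none: "\<not> (\<exists>x\<in>A. I x l)"
    have "card B \<le> card {x \<in> P. I x l}"
    proof (rule card_le_if_inj_on_rel[where r = "\<lambda>m x. I x m"])
      fix m assume "m \<in> B"
      then show "\<exists>x. x \<in> {x \<in> P. I x l} \<and> I x m" using common_point[of m l] sub l by blast
    next
      fix k m x assume km: "k \<in> B" "m \<in> B" "x \<in> {x \<in> P. I x l}" "I x k" "I x m"
      show "k = m"
      proof (rule ccontr)
        assume "k \<noteq> m"
        then obtain y where "y \<in> A" "I y k" "I y m" using S.lines_meet[of k m] km by blast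
        then have "y = x" using lines_meet[of k m] km sub \<open>k \<noteq> m\<close> by blast
        then show False using none km \<open>y \<in> A\<close> by blast
      qed
    qed (simp add: finite_P)
    then show False using card_points_on[of l] l S.card_lines r r_pos by simp
  qed
  have point: "\<exists>l\<in>B. I x l" if x: "x \<in> P - A" for x
  proof (rule ccontr)
    assume none: "\<not> (\<exists>l\<in>B. I x l)"
    have "card A \<le> card {l \<in> L. I x l}"
    proof (rule card_le_if_inj_on_rel[where r = I])
      fix y assume "y \<in> A"
      then show "\<exists>l. l \<in> {l \<in> L. I x l} \<and> I y l" using common_line[of y x] sub x by blast
    next
      fix y z l assume yz: "y \<in> A" "z \<in> A" "l \<in> {l \<in> L. I x l}" "I y l" "I z l"
      show "y = z"
      proof (rule ccontr)
        assume "y \<noteq> z"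
        then obtain m where "m \<in> B" "I y m" "I z m" using S.points_join[of y z] yz by blast
        then have "m = l" using points_join[of y z] yz sub \<open>y \<noteq> z\<close> by blast
        then show False using none yz \<open>m \<in> B\<close> by blast
      qed
    qed (simp add: finite_L)
    then show False using card_lines_through[of x] x S.card_points r r_pos by simp
  qed
  have "\<exists>!l. l \<in> B \<and> I x l" if x: "x \<in> P - A" for x
  proof (rule ex_ex1I)
    show "\<exists>l. l \<in> B \<and> I x l" using point[OF x] by blast
    show "k = m" if "k \<in> B \<and> I x k" "m \<in> B \<and> I x m" for k m
      using S.lines_meet[of k m] lines_meet[of k m] that sub x by blast
  qed
  moreover have "\<exists>!x. x \<in> A \<and> I x l" if l: "l \<in> L - B" for l
  proof (rule ex_ex1I)
    show "\<exists>x. x \<in> A \<and> I x l" using line[OF l] by blast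
    show "y = z" if "y \<in> A \<and> I y l" "z \<in> A \<and> I z l" for y z
      using S.points_join[of y z] points_join[of y z] that sub l by blast
  qed
  ultimately show "tight_configuration P L I A B" using sub by (auto simp: tight_configuration_def)
  show "card A + card B = 2 * (q + r + 1)" using S.card_points S.card_lines r by simp
qed

end


section \<open>The incidence graph\<close>

lemma incidence_graph_verts: "pverts (incidence_graph P L I) = P <+> L"
  by (simp add: incidence_graph_def)

lemma incidence_graph_arcs:
  "(Inl x, Inr l) \<in> parcs (incidence_graph P L I) \<longleftrightarrow> x \<in> P \<and> l \<in> L \<and> I x l"
  "(Inr l, Inl x) \<in> parcs (incidence_graph P L I) \<longleftrightarrow> x \<in> P \<and> l \<in> L \<and> I x l"
  "(Inl x, Inl y) \<notin> parcs (incidence_graph P L I)"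
  "(Inr l, Inr m) \<notin> parcs (incidence_graph P L I)"
  by (auto simp: incidence_graph_def)

lemma incidence_graph_moves:
  "Inl y \<in> moves (incidence_graph P L I) (Inl x) \<longleftrightarrow> y = x"
  "Inr m \<in> moves (incidence_graph P L I) (Inr l) \<longleftrightarrow> m = l"
  "Inr l \<in> moves (incidence_graph P L I) (Inl x) \<longleftrightarrow> x \<in> P \<and> l \<in> L \<and> I x l"
  "Inl x \<in> moves (incidence_graph P L I) (Inr l) \<longleftrightarrow> x \<in> P \<and> l \<in> L \<and> I x l"
  by (auto simp: moves_def incidence_graph_arcs)

lemmas incidence_graph_simps = incidence_graph_arcs incidence_graph_moves

context plane_of_order
begin

abbreviation G where "G \<equiv> incidence_graph P L I"

lemma pair_fin_digraph_incidence: "pair_fin_digraph G"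
proof -
  have sub: "parcs G \<subseteq> pverts G \<times> pverts G" by (auto simp: incidence_graph_def)
  moreover have fin: "finite (pverts G)" using finite_P finite_L by (simp add: incidence_graph_verts)
  ultimately have "finite (parcs G)" using finite_subset by blast
  then show ?thesis using sub fin by unfold_locales auto
qed

lemma card_verts: "card (pverts G) = 2 * (q\<^sup>2 + q + 1)"
  using finite_P finite_L card_points card_lines by (simp add: incidence_graph_verts card_Plus)

lemma two_points_on:
  assumes "l \<in> L" obtains x y where "x \<in> P" "y \<in> P" "x \<noteq> y" "I x l" "I y l"
proof -
  obtain T where "T \<subseteq> {x \<in> P. I x l}" "card T = 2"
    using obtain_subset_with_card_n[of 2 "{x \<in> P. I x l}"] card_points_on[OF assms] order_ge_2 by auto
  then show thesis using that by (auto simp: card_2_iff)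
qed

lemma two_lines_through:
  assumes "x \<in> P" obtains l m where "l \<in> L" "m \<in> L" "l \<noteq> m" "I x l" "I x m"
  using plane_of_order.two_points_on[OF dual assms] by blast

section \<open>Bounds on the damage number\<close>

text \<open>
  Two guarded neighbours of the robber's vertex would lie with it and the cop's position on a cycle of length at
  most four; there is none because two points have only one joining line.
\<close>

lemma robber_leaves_closed:
  assumes legal: "legal_cop G \<sigma>"
  obtains A B where "closed_configuration P L I A B" "A \<noteq> P \<or> B \<noteq> L"
    "2 * (q\<^sup>2 + q + 1) \<le> card (damaged \<sigma> (least_visited_strategy G)) + (card A + card B)"
proof -
  interpret G: pair_fin_digraph G by (rule pair_fin_digraph_incidence)
  let ?D = "damaged \<sigma> (least_visited_strategy G)"
  have "\<exists>V. V \<subset> pverts G \<and> pverts G - V \<subseteq> ?D \<and>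
    (\<forall>v \<in> pverts G - V. \<forall>w \<in> V. \<forall>w' \<in> V. (v, w) \<in> parcs G \<and> (v, w') \<in> parcs G \<longrightarrow> w = w')"
  proof (rule least_visited_strategy_evades[OF legal])
    show "pair_wf_digraph G" by (rule G.pair_wf_digraph_axioms)
    show "finite (pverts G)" by (rule G.pair_finite_verts)
    show "\<not> pverts G \<subseteq> moves G c" if "c \<in> pverts G" for c
    proof (cases c)
      case (Inl x)
      obtain l where "l \<in> L" using nonempty_L by blast
      then obtain y where "y \<in> P" "y \<noteq> x" by (metis two_points_on)
      then have "Inl y \<in> pverts G - moves G c" using Inl by (auto simp: incidence_graph_verts incidence_graph_simps)
      then show ?thesis by blast
    next
      case (Inr l)
      obtain x where "x \<in> P" using nonempty_P by blast
      then obtain m where "m \<in> L" "m \<noteq> l" by (metis two_lines_through)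
      then have "Inr m \<in> pverts G - moves G c" using Inr by (auto simp: incidence_graph_verts incidence_graph_simps)
      then show ?thesis by blast
    qed
    show "\<exists>w w'. w \<noteq> w' \<and> (r, w) \<in> parcs G \<and> (r, w') \<in> parcs G" if "r \<in> pverts G" for r
    proof (cases r)
      case (Inl x)
      then have "x \<in> P" using that by (auto simp: incidence_graph_verts)
      then obtain l m where lm: "l \<in> L" "m \<in> L" "l \<noteq> m" "I x l" "I x m" by (rule two_lines_through)
      show ?thesis by (rule exI[of _ "Inr l"], rule exI[of _ "Inr m"]) (use Inl \<open>x \<in> P\<close> lm in \<open>simp add: incidence_graph_simps\<close>)
    next
      case (Inr l)
      then have "l \<in> L" using that by (auto simp: incidence_graph_verts)
      then obtain x y where xy: "x \<in> P" "y \<in> P" "x \<noteq> y" "I x l" "I y l" by (rule two_points_on)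
      show ?thesis by (rule exI[of _ "Inl x"], rule exI[of _ "Inl y"]) (use Inr \<open>l \<in> L\<close> xy in \<open>simp add: incidence_graph_simps\<close>)
    qed
    show "w = w'" if "c \<noteq> r" "(r, w) \<in> parcs G" "(r, w') \<in> parcs G" "w \<in> moves G c" "w' \<in> moves G c" for c r w w'
      using that by (cases c; cases r; cases w; cases w') (auto simp: incidence_graph_simps dest: join_unique)
  qed
  then obtain V where V: "V \<subset> pverts G" "pverts G - V \<subseteq> ?D"
    and V_unique: "\<forall>v \<in> pverts G - V. \<forall>w \<in> V. \<forall>w' \<in> V. (v, w) \<in> parcs G \<and> (v, w') \<in> parcs G \<longrightarrow> w = w'"
    by (elim exE conjE)
  have unique: "w = w'"
    if "v \<in> pverts G" "v \<notin> V" "w \<in> V" "w' \<in> V" "(v, w) \<in> parcs G" "(v, w') \<in> parcs G" for v w w'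
    using V_unique[rule_format, of v w w'] that by simp
  define A B where "A = {x. Inl x \<in> V}" and "B = {l. Inr l \<in> V}"
  have V_eq: "V = A <+> B"
  proof (rule set_eqI)
    show "v \<in> V \<longleftrightarrow> v \<in> A <+> B" for v by (cases v) (auto simp: A_def B_def)
  qed
  have AB: "A \<subseteq> P" "B \<subseteq> L" using V(1) by (auto simp: A_def B_def incidence_graph_verts)
  have "l = m" if "x \<in> P" "x \<notin> A" "l \<in> B" "m \<in> B" "I x l" "I x m" for x l m
    using unique[of "Inl x" "Inr l" "Inr m"] that AB(2)
    by (auto simp: A_def B_def incidence_graph_verts incidence_graph_simps)
  moreover have "x = y" if "l \<in> L" "l \<notin> B" "x \<in> A" "y \<in> A" "I x l" "I y l" for l x y
    using unique[of "Inr l" "Inl x" "Inl y"] that AB(1)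
    by (auto simp: A_def B_def incidence_graph_verts incidence_graph_simps)
  ultimately have "closed_configuration P L I A B"
    using AB unfolding closed_configuration_def by blast
  moreover have "A \<noteq> P \<or> B \<noteq> L" using V(1) V_eq by (auto simp: incidence_graph_verts)
  moreover have "2 * (q\<^sup>2 + q + 1) \<le> card ?D + (card A + card B)"
  proof -
    have fin: "finite A" "finite B" using AB finite_P finite_L finite_subset by blast+
    have "?D \<subseteq> pverts G"
      using robber_pos_in_verts[OF G.pair_wf_digraph_axioms legal_least_visited_strategy] V(1)
      by (auto simp: damaged_def)
    then have finD: "finite ?D" using G.pair_finite_verts finite_subset by blast
    have "pverts G \<subseteq> ?D \<union> (A <+> B)" using V(2) V_eq by blast
    then have "card (pverts G) \<le> card (?D \<union> (A <+> B))" using finD fin by (intro card_mono) auto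
    also have "\<dots> \<le> card ?D + card (A <+> B)" by (rule card_Un_le)
    finally show ?thesis using fin by (simp add: card_verts card_Plus)
  qed
  ultimately show thesis using that by blast
qed

text \<open>
  The cop keeps to the side (points or lines) on which the robber is, so that both are adjacent to the
  robber's only neighbour \<open>s\<close> in \<open>S\<close>; if the robber moves to \<open>s\<close>, he is next to the cop. If he moves to a vertex
  whose only neighbour in \<open>S\<close> is \<open>s'\<close>, then the cop's position and \<open>s'\<close> are both points or both
  lines, so the cop can move to a common neighbour of the two.
\<close>

lemma cop_guards_tight:
  assumes legal: "legal_robber G \<rho>" and c0: "c0 \<in> pverts G"
    and t: "tight_configuration P L I A B"
  defines "S \<equiv> A <+> B"
  assumes init: "\<rho> [] c0 \<in> moves G c0 \<or> (\<rho> [] c0 \<notin> S \<and>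
      (\<exists>c\<in>moves G c0. \<exists>s\<in>S. (s, c) \<in> parcs G \<and> (s, \<rho> [] c0) \<in> parcs G))"
  obtains \<sigma> where "legal_cop G \<sigma>" "card (damaged \<sigma> \<rho>) + (card A + card B) \<le> 2 * (q\<^sup>2 + q + 1)"
proof -
  interpret G: pair_fin_digraph G by (rule pair_fin_digraph_incidence)
  have AB: "A \<subseteq> P" "B \<subseteq> L"
    and tP: "\<And>x. \<lbrakk>x \<in> P; x \<notin> A\<rbrakk> \<Longrightarrow> \<exists>!l. l \<in> B \<and> I x l"
    and tL: "\<And>l. \<lbrakk>l \<in> L; l \<notin> B\<rbrakk> \<Longrightarrow> \<exists>!x. x \<in> A \<and> I x l"
    using t unfolding tight_configuration_def by blast+
  have "\<exists>\<sigma>. legal_cop G \<sigma> \<and> damaged \<sigma> \<rho> \<inter> S = {}"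
  proof (rule guarding[where R = "\<lambda>c r. \<exists>s\<in>S. (s, c) \<in> parcs G \<and> (s, r) \<in> parcs G", OF legal c0 init])
    fix c r r'
    assume R: "\<exists>s\<in>S. (s, c) \<in> parcs G \<and> (s, r) \<in> parcs G" and r: "r \<notin> S"
      and r': "r' \<in> moves G r" "r' \<notin> S"
    show "\<exists>c'\<in>moves G c. \<exists>s\<in>S. (s, c') \<in> parcs G \<and> (s, r') \<in> parcs G"
    proof (cases "r' = r")
      case True
      then show ?thesis using R by (auto simp: moves_def)
    next
      case False
      obtain s where s: "s \<in> S" "(s, c) \<in> parcs G" "(s, r) \<in> parcs G" using R by blast
      show ?thesis
      proof (cases r)
        case (Inl x)
        then obtain m y where m: "r' = Inr m" "x \<in> P" "m \<in> L" "I x m" and y: "c = Inl y" "y \<in> P"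
          using s r' False by (cases r'; cases s; cases c) (auto simp: incidence_graph_simps)
        have "m \<notin> B" using r' m by (auto simp: S_def)
        then obtain z where z: "z \<in> A" "I z m" using tL m by blast
        then obtain k where k: "k \<in> L" "I y k" "I z k" using common_line[of y z] y AB by blast
        have "Inr k \<in> moves G c" "(Inl z, Inr k) \<in> parcs G" "(Inl z, r') \<in> parcs G" "Inl z \<in> S"
          using k y z m AB by (auto simp: incidence_graph_simps S_def)
        then show ?thesis by blast
      next
        case (Inr l)
        then obtain x k where x: "r' = Inl x" "l \<in> L" "x \<in> P" "I x l" and k: "c = Inr k" "k \<in> L"
          using s r' False by (cases r'; cases s; cases c) (auto simp: incidence_graph_simps)
        have "x \<notin> A" using r' x by (auto simp: S_def)
        then obtain m where m: "m \<in> B" "I x m" using tP x by blast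
        then obtain y where y: "y \<in> P" "I y k" "I y m" using common_point[of k m] k AB by blast
        have "Inl y \<in> moves G c" "(Inr m, Inl y) \<in> parcs G" "(Inr m, r') \<in> parcs G" "Inr m \<in> S"
          using y k m x AB by (auto simp: incidence_graph_simps S_def)
        then show ?thesis by blast
      qed
    qed
  next
    fix c r s'
    assume R: "\<exists>s\<in>S. (s, c) \<in> parcs G \<and> (s, r) \<in> parcs G" and r: "r \<notin> S"
      and s': "s' \<in> moves G r" "s' \<in> S"
    obtain s where s: "s \<in> S" "(s, c) \<in> parcs G" "(s, r) \<in> parcs G" using R by blast
    have "s' \<noteq> r" using r s' by blast
    have "s = s'"
    proof (cases r)
      case (Inl x)
      then obtain l m where "s = Inr l" "s' = Inr m" "x \<in> P" "I x l" "I x m" "l \<in> B" "m \<in> B" "x \<notin> A"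
        using s s' r \<open>s' \<noteq> r\<close> by (cases s; cases s') (auto simp: incidence_graph_simps S_def)
      then show ?thesis using tP[of x] by blast
    next
      case (Inr l)
      then obtain x y where "s = Inl x" "s' = Inl y" "l \<in> L" "I x l" "I y l" "x \<in> A" "y \<in> A" "l \<notin> B"
        using s s' r \<open>s' \<noteq> r\<close> by (cases s; cases s') (auto simp: incidence_graph_simps S_def)
      then show ?thesis using tL[of l] by blast
    qed
    then show "s' \<in> moves G c" using s(2)
      by (cases s; cases c) (auto simp: incidence_graph_simps)
  qed
  then obtain \<sigma> where \<sigma>: "legal_cop G \<sigma>" "damaged \<sigma> \<rho> \<inter> S = {}" by blast
  have fin: "finite A" "finite B" using AB finite_P finite_L finite_subset by blast+
  have "damaged \<sigma> \<rho> \<subseteq> pverts G"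
    using robber_pos_in_verts[OF G.pair_wf_digraph_axioms legal] by (auto simp: damaged_def)
  then have sub: "damaged \<sigma> \<rho> \<union> S \<subseteq> pverts G" using AB by (auto simp: S_def incidence_graph_verts)
  then have "finite (damaged \<sigma> \<rho>)" using G.pair_finite_verts finite_subset by blast
  then have "card (damaged \<sigma> \<rho>) + card S = card (damaged \<sigma> \<rho> \<union> S)"
    using \<sigma>(2) fin by (simp add: card_Un_disjoint S_def)
  also have "\<dots> \<le> card (pverts G)" using sub G.pair_finite_verts by (rule card_mono[rotated])
  finally show thesis using that \<sigma>(1) fin by (simp add: card_verts card_Plus S_def)
qed

text \<open>
  The cop starts at \<open>j\<close>. If the robber starts at a point \<open>y\<close>, the cop moves to the intersection of \<open>j\<close> with the
  line of the configuration through \<open>y\<close>, so any configuration avoiding \<open>y\<close> will do. If the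
  robber starts at a line \<open>m\<close>, the cop cannot reach another line in one move, so \<open>j\<close> itself must pass through the
  point of the configuration on \<open>m\<close>.
\<close>

lemma dmg_le:
  assumes j: "j \<in> L"
    and point: "\<And>y. \<lbrakk>y \<in> P; \<not> I y j\<rbrakk> \<Longrightarrow>
      \<exists>A B. tight_configuration P L I A B \<and> y \<notin> A \<and> card A + card B = K"
    and line: "\<And>m. \<lbrakk>m \<in> L; m \<noteq> j\<rbrakk> \<Longrightarrow>
      \<exists>A B. tight_configuration P L I A B \<and> m \<notin> B \<and> (\<exists>p\<in>A. I p j \<and> I p m) \<and> card A + card B = K"
  shows "dmg G + K \<le> 2 * (q\<^sup>2 + q + 1)"
proof -
  have ne: "pverts G \<noteq> {}" using j by (auto simp: incidence_graph_verts)
  obtain \<rho> where \<rho>: "legal_robber G \<rho>" "\<And>\<sigma>. legal_cop G \<sigma> \<Longrightarrow> dmg G \<le> card (damaged \<sigma> \<rho>)"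
    using robber_guarantees_dmg[OF pair_fin_digraph_incidence ne] unfolding robber_guarantees_def by blast
  let ?c = "Inr j :: 'p + 'l"
  let ?r = "\<rho> [] ?c"
  have c: "?c \<in> pverts G" using j by (auto simp: incidence_graph_verts)
  have r: "?r \<in> pverts G" using \<rho>(1) by (simp add: legal_robber_def)
  have "\<exists>A B. tight_configuration P L I A B \<and> card A + card B = K \<and>
     (?r \<in> moves G ?c \<or> (?r \<notin> A <+> B \<and>
      (\<exists>c\<in>moves G ?c. \<exists>s\<in>A <+> B. (s, c) \<in> parcs G \<and> (s, ?r) \<in> parcs G)))"
  proof (cases "?r \<in> moves G ?c")
    \<comment> \<open>The robber is captured at once, so any tight configuration of size \<open>K\<close> serves.\<close>
    case True
    obtain x where "x \<in> P" using nonempty_P by blast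
    then obtain m where "m \<in> L" "m \<noteq> j" by (metis two_lines_through)
    then show ?thesis using line[of m] True by blast
  next
    case False
    show ?thesis
    proof (cases ?r)
      case (Inl y)
      then have y: "y \<in> P" "\<not> I y j" using r False j by (auto simp: incidence_graph_verts incidence_graph_simps)
      then obtain A B where t: "tight_configuration P L I A B" "y \<notin> A" "card A + card B = K"
        using point by blast
      then obtain k where k: "k \<in> B" "k \<in> L" "I y k" using y unfolding tight_configuration_def by blast
      then obtain z where z: "z \<in> P" "I z k" "I z j" using common_point[of k j] j by blast
      have "?r \<notin> A <+> B" "Inl z \<in> moves G ?c" "Inr k \<in> A <+> B"
        "(Inr k, Inl z) \<in> parcs G" "(Inr k, ?r) \<in> parcs G"
        using t k z y j Inl by (auto simp: incidence_graph_simps)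
      then show ?thesis using t by blast
    next
      case (Inr m)
      then have m: "m \<in> L" "m \<noteq> j" using r False by (auto simp: incidence_graph_verts incidence_graph_simps)
      then obtain A B p where t: "tight_configuration P L I A B" "m \<notin> B" "card A + card B = K"
        and p: "p \<in> A" "I p j" "I p m" using line by blast
      have "p \<in> P" using t p by (auto simp: tight_configuration_def)
      then have "?r \<notin> A <+> B" "?c \<in> moves G ?c" "Inl p \<in> A <+> B"
        "(Inl p, ?c) \<in> parcs G" "(Inl p, ?r) \<in> parcs G"
        using t m p j Inr by (auto simp: incidence_graph_simps)
      then show ?thesis using t by blast
    qed
  qed
  then obtain A B where t: "tight_configuration P L I A B" "card A + card B = K"
    and init: "?r \<in> moves G ?c \<or> (?r \<notin> A <+> B \<and>
      (\<exists>c\<in>moves G ?c. \<exists>s\<in>A <+> B. (s, c) \<in> parcs G \<and> (s, ?r) \<in> parcs G))" by blast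
  obtain \<sigma> where "legal_cop G \<sigma>" "card (damaged \<sigma> \<rho>) + (card A + card B) \<le> 2 * (q\<^sup>2 + q + 1)"
    using cop_guards_tight[OF \<rho>(1) c t(1) init] by blast
  then show ?thesis using \<rho>(2)[of \<sigma>] t(2) by simp
qed

lemma point_off_lines:
  assumes "j \<in> L" "m \<in> L" obtains x where "x \<in> P" "\<not> I x j" "\<not> I x m"
proof -
  have "card ({x \<in> P. I x j} \<union> {x \<in> P. I x m}) \<le> (q + 1) + (q + 1)"
    using card_Un_le[of "{x \<in> P. I x j}" "{x \<in> P. I x m}"] card_points_on assms by simp
  also have "\<dots> < card P"
  proof -
    have "2 * q \<le> q\<^sup>2" using order_ge_2 by (simp add: power2_eq_square)
    then show ?thesis using order_ge_2 unfolding card_points by linarith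
  qed
  finally have "{x \<in> P. I x j} \<union> {x \<in> P. I x m} \<noteq> P" by (metis less_irrefl)
  then show thesis using that by blast
qed

lemma dmg_le_antiflag: "dmg G + (2 * q + 4) \<le> 2 * (q\<^sup>2 + q + 1)"
proof -
  obtain j where j: "j \<in> L" using nonempty_L by blast
  show ?thesis
  proof (rule dmg_le[OF j])
    fix y assume y: "y \<in> P" "\<not> I y j"
    obtain l where l: "l \<in> L" "I y l" using two_lines_through[OF y(1)] by blast
    obtain x where x: "x \<in> P" "\<not> I x j" "\<not> I x l" using point_off_lines[OF j l(1)] by blast
    show "\<exists>A B. tight_configuration P L I A B \<and> y \<notin> A \<and> card A + card B = 2 * q + 4"
      by (intro exI conjI, rule antiflag_tight(1)[OF x(1) j x(2)], use x(3) l(2) y(2) in blast,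
          rule antiflag_tight(2)[OF x(1) j x(2)])
  next
    fix m assume m: "m \<in> L" "m \<noteq> j"
    obtain x where x: "x \<in> P" "\<not> I x j" "\<not> I x m" using point_off_lines[OF j m(1)] by blast
    obtain p where p: "p \<in> P" "I p j" "I p m" using common_point[of j m] j m by blast
    show "\<exists>A B. tight_configuration P L I A B \<and> m \<notin> B \<and> (\<exists>p\<in>A. I p j \<and> I p m) \<and> card A + card B = 2 * q + 4"
      by (intro exI conjI, rule antiflag_tight(1)[OF x(1) j x(2)], use x(3) m(2) in blast,
          use p in blast, rule antiflag_tight(2)[OF x(1) j x(2)])
  qed
qed

lemma automorphism_between_points:
  assumes "doubly_transitive P L I" and "x \<in> P" "y \<in> P" "x' \<in> P" "y' \<in> P" "x \<noteq> y" "x' \<noteq> y'"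
  obtains f g where "plane_automorphism P L I f g" "f x = x'" "f y = y'"
proof -
  have "\<exists>f g. plane_automorphism P L I f g \<and> f x = x' \<and> f y = y'"
    using assms(1)[unfolded doubly_transitive_def, THEN conjunct1, rule_format, of x y x' y'] assms(2-)
    by simp
  then show thesis using that by (elim exE conjE)
qed

lemma automorphism_between_lines:
  assumes "doubly_transitive P L I" and "l \<in> L" "m \<in> L" "l' \<in> L" "m' \<in> L" "l \<noteq> m" "l' \<noteq> m'"
  obtains f g where "plane_automorphism P L I f g" "g l = l'" "g m = m'"
proof -
  have "\<exists>f g. plane_automorphism P L I f g \<and> g l = l' \<and> g m = m'"
    using assms(1)[unfolded doubly_transitive_def, THEN conjunct2, rule_format, of l m l' m'] assms(2-)
    by simp
  then show thesis using that by (elim exE conjE)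
qed

text \<open>
  Automorphisms move the given Baer subplane to where the cop needs it. For a point \<open>y\<close>, some
  point \<open>y0\<close> outside the subplane is moved to \<open>y\<close>. For a line \<open>m\<close>, a line \<open>m0\<close> outside the subplane and a line \<open>j0\<close>
  that meets \<open>m0\<close> in a point of the subplane are moved simultaneously to \<open>m\<close> and \<open>j\<close>.
\<close>

lemma dmg_le_Baer:
  assumes sub: "A \<subseteq> P" "B \<subseteq> L" "plane_of_order A B I r" and r: "r\<^sup>2 = q"
    and dt: "doubly_transitive P L I"
  shows "dmg G + 2 * (q + r + 1) \<le> 2 * (q\<^sup>2 + q + 1)"
proof -
  interpret S: plane_of_order A B I r by (rule sub)
  note t = Baer_tight[OF sub r]
  have "r < q" unfolding r[symmetric] using S.order_ge_2 by (simp add: power2_eq_square)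
  moreover have "q \<le> q\<^sup>2" using order_ge_2 by (simp add: power2_eq_square)
  ultimately have "card A < card P" "card B < card L"
    unfolding S.card_points S.card_lines card_points card_lines r by linarith+
  then have "A \<noteq> P" "B \<noteq> L" by auto
  then obtain y0 m0 where y0: "y0 \<in> P" "y0 \<notin> A" and m0: "m0 \<in> L" "m0 \<notin> B"
    using sub(1,2) by blast
  have "\<exists>!p. p \<in> A \<and> I p m0" using t(1) m0 unfolding tight_configuration_def by blast
  then obtain p where p: "p \<in> A" "I p m0" by blast
  then have "p \<in> P" using sub(1) by blast
  then obtain j0 where j0: "j0 \<in> L" "I p j0" "j0 \<noteq> m0" by (metis two_lines_through)
  obtain z0 where z0: "z0 \<in> P" "z0 \<noteq> y0" using \<open>p \<in> P\<close> p(1) y0 by metis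
  obtain j where j: "j \<in> L" using nonempty_L by blast
  show ?thesis
  proof (rule dmg_le[OF j])
    fix y assume y: "y \<in> P" "\<not> I y j"
    obtain z where z: "z \<in> P" "z \<noteq> y" using two_points_on[OF j] by metis
    obtain f g where fg: "plane_automorphism P L I f g" "f y0 = y"
      by (rule automorphism_between_points[OF dt y0(1) z0(1) y(1) z(1) z0(2)[symmetric] z(2)[symmetric]])
    have "inj_on f P" using fg(1) by (simp add: plane_automorphism_def bij_betw_def)
    then have "y \<notin> f ` A" using fg(2) y0 sub(1) inj_on_image_mem_iff[of f P y0 A] by simp
    then show "\<exists>A B. tight_configuration P L I A B \<and> y \<notin> A \<and> card A + card B = 2 * (q + r + 1)"
      using tight_configuration_image[OF fg(1) t(1)] t(2)
      by (intro exI[of _ "f ` A"] exI[of _ "g ` B"]) simp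
  next
    fix m assume m: "m \<in> L" "m \<noteq> j"
    obtain f g where fg: "plane_automorphism P L I f g" "g j0 = j" "g m0 = m"
      by (rule automorphism_between_lines[OF dt j0(1) m0(1) j m(1) j0(3) m(2)[symmetric]])
    have "inj_on g L" using fg(1) by (simp add: plane_automorphism_def bij_betw_def)
    then have "m \<notin> g ` B" using fg(3) m0 sub(2) inj_on_image_mem_iff[of g L m0 B] by simp
    moreover have "I (f p) (g j0)" "I (f p) (g m0)"
      using fg(1) p j0 m0 sub(1) by (simp_all add: plane_automorphism_def subset_iff)
    then have "\<exists>p'\<in>f ` A. I p' j \<and> I p' m" using p(1) fg(2,3) by blast
    ultimately show "\<exists>A B. tight_configuration P L I A B \<and> m \<notin> B \<and> (\<exists>p\<in>A. I p j \<and> I p m) \<and>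
        card A + card B = 2 * (q + r + 1)"
      using tight_configuration_image[OF fg(1) t(1)] t(2)
      by (intro exI[of _ "f ` A"] exI[of _ "g ` B"]) simp
  qed
qed

text \<open>The bound \<open>K\<close> is real because the one for Baer subplanes involves \<open>\<surd>q\<close>, also when \<open>q\<close> is not a square.\<close>

lemma le_dmg:
  assumes "\<And>A B. \<lbrakk>closed_configuration P L I A B; A \<noteq> P \<or> B \<noteq> L\<rbrakk> \<Longrightarrow> real (card A + card B) \<le> K"
  shows "2 * (real q ^ 2 + real q + 1) - K \<le> real (dmg G)"
proof -
  let ?k = "nat \<lceil>2 * (real q ^ 2 + real q + 1) - K\<rceil>"
  have ne: "pverts G \<noteq> {}" using nonempty_L by (auto simp: incidence_graph_verts)
  have "?k \<le> card (damaged \<sigma> (least_visited_strategy G))" if legal: "legal_cop G \<sigma>" for \<sigma>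
  proof -
    obtain A B where AB: "closed_configuration P L I A B" "A \<noteq> P \<or> B \<noteq> L"
      "2 * (q\<^sup>2 + q + 1) \<le> card (damaged \<sigma> (least_visited_strategy G)) + (card A + card B)"
      by (rule robber_leaves_closed[OF legal])
    have "real (2 * (q\<^sup>2 + q + 1)) \<le> real (card (damaged \<sigma> (least_visited_strategy G)) + (card A + card B))"
      using AB(3) by (simp only: of_nat_le_iff)
    then have "2 * (real q ^ 2 + real q + 1) - K \<le> real (card (damaged \<sigma> (least_visited_strategy G)))"
      using assms[OF AB(1,2)] by simp
    then show ?thesis by linarith
  qed
  then have "robber_guarantees G ?k"
    unfolding robber_guarantees_def using legal_least_visited_strategy[OF ne] by blast
  then have "?k \<le> dmg G" by (rule robber_guarantees_le_dmg[OF pair_fin_digraph_incidence ne])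
  then show ?thesis by linarith
qed

end

theorem theorem1p6:
  fixes P :: "'p set" and L :: "'l set" and I :: "'p \<Rightarrow> 'l \<Rightarrow> bool" and q :: nat
  assumes "finite_projective_plane P L I"
    and "has_order P L I q"
  shows "2 * real q ^ 2 - 2 * sqrt (real q) \<le> real (dmg (incidence_graph P L I)) \<and>
         real (dmg (incidence_graph P L I)) \<le> 2 * real q ^ 2 - 2 \<and>
         (\<not> contains_Baer_subplane P L I q \<longrightarrow>
            real (dmg (incidence_graph P L I)) = 2 * real q ^ 2 - 2) \<and>
         (contains_Baer_subplane P L I q \<and> doubly_transitive P L I \<longrightarrow>
            real (dmg (incidence_graph P L I)) = 2 * real q ^ 2 - 2 * sqrt (real q))"
proof -
  interpret FP: finite_projective_plane P L I by fact
  interpret plane_of_order P L I q by (rule FP.plane_of_orderI) fact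
  have q: "real q = sqrt (real q) ^ 2" "1 \<le> sqrt (real q)" using order_ge_2 by auto
  have Baer_if_large: "\<exists>r. real r = sqrt (real q) \<and> subplane A B P L I \<and> has_order A B I r \<and>
      card A + card B = 2 * (q + r + 1)"
    if large: "closed_configuration P L I A B" "A \<noteq> P \<or> B \<noteq> L" "2 * q + 4 < card A + card B" for A B
  proof -
    obtain r where r: "r\<^sup>2 = q" "subplane A B P L I" "has_order A B I r" "card A + card B = 2 * (q + r + 1)"
      using large_closed_is_Baer[OF large] by metis
    moreover have "real r = sqrt (real q)" unfolding r(1)[symmetric] by simp
    ultimately show ?thesis by blast
  qed
  have lower: "2 * real q ^ 2 - 2 * sqrt (real q) \<le> real (dmg G)"
  proof -
    have "2 * (real q ^ 2 + real q + 1) - (2 * real q + 2 * sqrt (real q) + 2) \<le> real (dmg G)"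
    proof (rule le_dmg)
      fix A :: "'p set" and B :: "'l set"
      assume AB: "closed_configuration P L I A B" "A \<noteq> P \<or> B \<noteq> L"
      show "real (card A + card B) \<le> 2 * real q + 2 * sqrt (real q) + 2"
      proof (cases "2 * q + 4 < card A + card B")
        case True
        then obtain r where "real r = sqrt (real q)" "card A + card B = 2 * (q + r + 1)"
          using Baer_if_large[OF AB] by blast
        then show ?thesis by simp
      next
        case False
        then have "real (card A + card B) \<le> 2 * real q + 4" by linarith
        then show ?thesis using q(2) by linarith
      qed
    qed
    then show ?thesis by (simp add: algebra_simps)
  qed
  have upper: "real (dmg G) \<le> 2 * real q ^ 2 - 2"
  proof -
    have "real (dmg G + (2 * q + 4)) \<le> real (2 * (q\<^sup>2 + q + 1))"
      using dmg_le_antiflag by (simp only: of_nat_le_iff)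
    then show ?thesis by simp
  qed
  have no_Baer: "2 * real q ^ 2 - 2 \<le> real (dmg G)" if none: "\<not> contains_Baer_subplane P L I q"
  proof -
    have "2 * (real q ^ 2 + real q + 1) - (2 * real q + 4) \<le> real (dmg G)"
    proof (rule le_dmg)
      fix A :: "'p set" and B :: "'l set"
      assume AB: "closed_configuration P L I A B" "A \<noteq> P \<or> B \<noteq> L"
      have "\<not> 2 * q + 4 < card A + card B"
        using Baer_if_large[OF AB] none unfolding contains_Baer_subplane_def by blast
      then show "real (card A + card B) \<le> 2 * real q + 4" by linarith
    qed
    then show ?thesis by simp
  qed
  have Baer: "real (dmg G) \<le> 2 * real q ^ 2 - 2 * sqrt (real q)"
    if contains: "contains_Baer_subplane P L I q" and dt: "doubly_transitive P L I"
  proof -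
    obtain A B r where sub: "subplane A B P L I" "has_order A B I r" and r: "real r = sqrt (real q)"
      using contains unfolding contains_Baer_subplane_def by blast
    have AB: "A \<subseteq> P" "B \<subseteq> L" "plane_of_order A B I r"
      using sub finite_projective_plane.plane_of_orderI unfolding subplane_def by blast+
    have "real (r\<^sup>2) = real q" using r q(1) by simp
    then have "r\<^sup>2 = q" by (simp only: of_nat_eq_iff)
    then have "real (dmg G + 2 * (q + r + 1)) \<le> real (2 * (q\<^sup>2 + q + 1))"
      using dmg_le_Baer[OF AB _ dt] by (simp only: of_nat_le_iff)
    then show ?thesis using r by simp
  qed
  show ?thesis using lower upper no_Baer Baer by (auto intro: antisym)
qed

end
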